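(* Let $A:X\to Y$ be a bounded linear operator between Banach spaces over $\mathbb{K}\in\{\mathbb{R},\mathbb{C}\}$. (i) $A$ is asymptotically uniformly flattenable if and only if there exists $C>0$ such that $A$ satisfies $C$-$c_0$ upper tree estimates. (ii) For any $1<p<\infty$, $A$ is $p$-asymptotically uniformly smoothable if and only if there exists $C>0$ such that $A$ satisfies $C$-$\ell_p$ upper tree estimates.
   Context: For $\sigma>0$ the modulus of asymptotic uniform smoothness of $A$ is $\rho(\sigma,A)=\sup\{\limsup_\lambda\|y+Ax_\lambda\|-1 : y\in B_Y,\ (x_\lambda)\text{ a weakly null net in }\sigma B_X\}$ (and $\rho(\sigma,A)=0$ if $A=0$). For $1<p<\infty$, $A$ is $p$-asymptotically uniformly smooth if $\sup_{\sigma>0}\rho(\sigma,A)/\sigma^p<\infty$; $A$ is asymptotically uniformly flat if $\rho(\sigma,A)=0$ for some $\sigma>0$. $A$ is $p$-asymptotically uniformly smoothable (resp. asymptotically uniformly flattenable) if there is an equivalent norm $|\cdot|$ on $Y$ such that $A:X\to(Y,|\cdot|)$ is $p$-asymptotically uniformly smooth (resp. asymptotically uniformly flat). Upper tree estimates: let $D$ be a neighborhood basis of $0$ in the weak topology of $X$, directed by reverse inclusion ($u\le v$ iff $v\subset u$). A subset $D_0\subset D$ is cofinal if for each $u\in D$ there is $v\in D_0$ with $u\le v$, and eventual if $D\setminus D_0$ is not cofinal. Let $D^n$ be the set of $n$-tuples of elements of $D$, $D^{<\mathbb N}=\bigcup_{n\ge1}D^n$, and for $t=(u_i)_{i=1}^n$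 and $m\le n$ let $t|_m=(u_i)_{i=1}^m$. A set $B\subset D^{<\mathbb N}$ is inevitable if $\{u\in D:(u)\in B\}$ is eventual and for every $(u_i)_{i=1}^n\in B$ the set $\{u\in D:(u_1,\dots,u_n,u)\in B\}$ is eventual; $B$ is big if it contains an inevitable subset. A family $(x_t)_{t\in D^{<\mathbb N}}\subset X$ is normally weakly null if $x_t\in u_n$ whenever $t=(u_i)_{i=1}^n$. For $C>0$ and $1<p<\infty$, $A$ satisfies $C$-$\ell_p$ upper tree estimates if for every normally weakly null $(x_t)_{t\in D^{<\mathbb N}}\subset B_X$ the set $\bigcup_{n}\{t\in D^n: \|A\sum_{i=1}^n a_ix_{t|_i}\|\le C(\sum_{i=1}^n|a_i|^p)^{1/p}\text{ for all }(a_i)_{i=1}^n\in\mathbb K^n\}$ is big. $C$-$c_0$ upper tree estimates are defined the same way with $(\sum|a_i|^p)^{1/p}$ replaced by $\max_i|a_i|$. (These notions do not depend on the choice of $D$.) *)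

theory Defs
  imports "HOL-Analysis.Analysis" "HOL-Library.Liminf_Limsup"
begin

text \<open>A complex Banach space is encoded as a real Banach space together with a
  complex structure J (multiplication by i).  Scalar multiplication by c is
  sc J c x = Re c x + Im c J x.  For K = real, only real scalars are used and J
  plays no role.\<close>

definition sc :: "('a::real_vector \<Rightarrow> 'a) \<Rightarrow> complex \<Rightarrow> 'a \<Rightarrow> 'a" where
  "sc J c x = Re c *\<^sub>R x + Im c *\<^sub>R J x"

definition complex_structure :: "('a::real_normed_vector \<Rightarrow> 'a) \<Rightarrow> bool" where
  "complex_structure J \<longleftrightarrow> linear J \<and> (\<forall>x. J (J x) = - x) \<and>
     (\<forall>c x. norm (sc J c x) = cmod c * norm x)"

definition weakly_null_net :: "'a::real_normed_vector filter \<Rightarrow> bool" where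
  "weakly_null_net F \<longleftrightarrow> F \<noteq> bot \<and>
     (\<forall>f::'a \<Rightarrow> real. bounded_linear f \<longrightarrow> ((\<lambda>x. f x) \<longlongrightarrow> 0) F)"

definition weak_nbhds0 :: "'a::real_normed_vector set set" where
  "weak_nbhds0 = {U. \<exists>S e. finite S \<and> (\<forall>f\<in>S. bounded_linear (f::'a \<Rightarrow> real)) \<and> e > 0 \<and>
                       {x. \<forall>f\<in>S. \<bar>f x\<bar> < e} \<subseteq> U}"

definition aus_mod :: "('b::real_normed_vector \<Rightarrow> real) \<Rightarrow> ('a::real_normed_vector \<Rightarrow> 'b) \<Rightarrow> real \<Rightarrow> ereal" where
  "aus_mod N A \<sigma> = (if A = (\<lambda>_. 0) then 0 else
     (SUP yF \<in> {(y, F). N y \<le> 1 \<and> weakly_null_net F \<and> eventually (\<lambda>x. norm x \<le> \<sigma>) F}.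
        Limsup (snd yF) (\<lambda>x. ereal (N (fst yF + A x))) - 1))"

definition p_AUS :: "('b::real_normed_vector \<Rightarrow> real) \<Rightarrow> real \<Rightarrow> ('a::real_normed_vector \<Rightarrow> 'b) \<Rightarrow> bool" where
  "p_AUS N p A \<longleftrightarrow> (\<exists>M::real. \<forall>\<sigma>>0. aus_mod N A \<sigma> \<le> ereal (M * \<sigma> powr p))"

definition AUF :: "('b::real_normed_vector \<Rightarrow> real) \<Rightarrow> ('a::real_normed_vector \<Rightarrow> 'b) \<Rightarrow> bool" where
  "AUF N A \<longleftrightarrow> (\<exists>\<sigma>>0. aus_mod N A \<sigma> = 0)"

definition equiv_K_norm :: "complex set \<Rightarrow> ('b::real_normed_vector \<Rightarrow> 'b) \<Rightarrow> ('b \<Rightarrow> real) \<Rightarrow> bool" where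
  "equiv_K_norm K J N \<longleftrightarrow> (\<forall>y. 0 \<le> N y) \<and> (\<forall>y. N y = 0 \<longrightarrow> y = 0) \<and>
     (\<forall>y z. N (y + z) \<le> N y + N z) \<and> (\<forall>c\<in>K. \<forall>y. N (sc J c y) = cmod c * N y) \<and>
     (\<exists>a b. 0 < a \<and> 0 < b \<and> (\<forall>y. a * norm y \<le> N y \<and> N y \<le> b * norm y))"

definition p_AUS_able :: "complex set \<Rightarrow> ('b::real_normed_vector \<Rightarrow> 'b) \<Rightarrow> real \<Rightarrow> ('a::real_normed_vector \<Rightarrow> 'b) \<Rightarrow> bool" where
  "p_AUS_able K J p A \<longleftrightarrow> (\<exists>N. equiv_K_norm K J N \<and> p_AUS N p A)"

definition AUF_able :: "complex set \<Rightarrow> ('b::real_normed_vector \<Rightarrow> 'b) \<Rightarrow> ('a::real_normed_vector \<Rightarrow> 'b) \<Rightarrow> bool" where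
  "AUF_able K J A \<longleftrightarrow> (\<exists>N. equiv_K_norm K J N \<and> AUF N A)"

text \<open>Elements of D^{<N} are nonempty lists over D; t|_m is take m t.\<close>
definition tuples :: "'x set \<Rightarrow> 'x list set" where
  "tuples D = {t. t \<noteq> [] \<and> set t \<subseteq> D}"

text \<open>D0 eventual: D minus D0 is not cofinal (order u \<le> v iff v \<subseteq> u).\<close>
definition eventual :: "'a set set \<Rightarrow> 'a set set \<Rightarrow> bool" where
  "eventual D D0 \<longleftrightarrow> \<not> (\<forall>u\<in>D. \<exists>v\<in>D - D0. v \<subseteq> u)"

definition inevitable :: "'a set set \<Rightarrow> 'a set list set \<Rightarrow> bool" where
  "inevitable D B \<longleftrightarrow> B \<subseteq> tuples D \<and> eventual D {u\<in>D. [u] \<in> B} \<and>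
     (\<forall>t\<in>B. eventual D {u\<in>D. t @ [u] \<in> B})"

definition big :: "'a set set \<Rightarrow> 'a set list set \<Rightarrow> bool" where
  "big D B \<longleftrightarrow> (\<exists>B'\<subseteq>B. inevitable D B')"

definition normally_weakly_null :: "'a set set \<Rightarrow> ('a set list \<Rightarrow> 'a) \<Rightarrow> bool" where
  "normally_weakly_null D x \<longleftrightarrow> (\<forall>t\<in>tuples D. x t \<in> last t)"

definition upper_tree_est :: "complex set \<Rightarrow> ('a::real_normed_vector \<Rightarrow> 'a) \<Rightarrow> ('a \<Rightarrow> 'b::real_normed_vector)
    \<Rightarrow> real \<Rightarrow> ((nat \<Rightarrow> complex) \<Rightarrow> nat \<Rightarrow> real) \<Rightarrow> bool" where
  "upper_tree_est K J A C phi \<longleftrightarrow>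
     (\<forall>x. normally_weakly_null weak_nbhds0 x \<and> (\<forall>t\<in>tuples weak_nbhds0. norm (x t) \<le> 1) \<longrightarrow>
        big weak_nbhds0 {t \<in> tuples weak_nbhds0. \<forall>a. (\<forall>i. a i \<in> K) \<longrightarrow>
           norm (A (\<Sum>i<length t. sc J (a i) (x (take (Suc i) t)))) \<le> C * phi a (length t)})"

definition lp_ute :: "complex set \<Rightarrow> ('a::real_normed_vector \<Rightarrow> 'a) \<Rightarrow> real \<Rightarrow> ('a \<Rightarrow> 'b::real_normed_vector) \<Rightarrow> real \<Rightarrow> bool" where
  "lp_ute K J p A C \<longleftrightarrow>
     upper_tree_est K J A C (\<lambda>a n. (\<Sum>i<n. cmod (a i) powr p) powr (1 / p))"

definition c0_ute :: "complex set \<Rightarrow> ('a::real_normed_vector \<Rightarrow> 'a) \<Rightarrow> ('a \<Rightarrow> 'b::real_normed_vector) \<Rightarrow> real \<Rightarrow> bool" where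
  "c0_ute K J A C \<longleftrightarrow>
     upper_tree_est K J A C (\<lambda>a n. Max ((\<lambda>i. cmod (a i)) ` {..<n}))"

end

theory Submission
  imports Defs
begin

text \<open>Both properties of \<open>A\<close> are read as statements about a game in which one player names weak
  neighbourhoods of zero and the other answers with vectors of the unit ball in them. From upper tree
  estimates one gets a new norm as the gauge of a sublevel set of the value of this game: the value
  dominates the old norm (or its \<open>p\<close>-th power), inherits convexity from it, is bounded thanks to
  the tree estimates, and by construction grows in a controlled way under weakly null
  perturbations. Conversely, for a norm witnessing asymptotic smoothness, the good tuples of a tree
  are extended one vector at a time; the constant is allowed to increase slightly in each step, so
  that finitely many coefficient vectors suffice. Complex coefficients are split into real
  and imaginary parts.\<close>

text \<open>If \<open>exceeds\<close> fails at \<open>y\<close> for a level \<open>T\<close>, then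
  by the rule \<open>step\<close> it fails for the level \<open>T + \<delta> \<sigma>\<close> at all
  points \<open>y + \<sigma> *\<^sub>R A x\<close> with \<open>x\<close> in the unit ball and in
  some weak neighbourhood. If the origin does not exceed a level \<open>c0 < T\<close>, convexity
  shows that division by \<open>1 + \<delta> \<sigma> / (T - c0)\<close> brings these points back to
  level \<open>T\<close>, so \<open>\<delta> \<sigma> / (T - c0)\<close> bounds the modulus of the
  gauge. The cost thus dictates the smoothness: a multiple of \<open>\<sigma> powr p\<close> for the
  power of the norm, and cost zero at the single size 1 for flatness. The obstacle is to bound the
  value, since tree estimates speak about one tree at a time: a derivation of \<open>exceeds\<close>
  has to be glued into a single family of vectors indexed by tuples. In the converse direction a
  smooth norm gives the one-step inequality \<open>N (y + r *\<^sub>R A x) \<le> f (N y) (C *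
  \<bar>r\<bar>) + \<eta>\<close>, where \<open>f\<close> is the maximum or the
  \<open>p\<close>-norm of a pair. The neighbourhood in it depends on \<open>y\<close> and
  \<open>r\<close>, hence on the coefficients, and this dependence is what has to be
  removed.\<close>

section \<open>Convexity of powers of the norm\<close>

lemma powr_convex_nonneg:
  assumes "(p::real) \<ge> 1"
  shows "convex_on {0..} (\<lambda>x. x powr p)"
proof (rule convex_onI)
  fix t x y :: real
  assume t: "0 < t" "t < 1" and xy: "x \<in> {0..}" "y \<in> {0..}"
  \<comment> \<open>If one endpoint is 0, where \<open>0 powr p = 0\<close>, convexity reduces to
    \<open>s powr p \<le> s\<close> for \<open>s\<close> between 0 and 1.\<close>
  have zero: "(s * z) powr p \<le> s * z powr p" if "0 < s" "s < 1" "0 \<le> z" for s z :: real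
  proof -
    have "s powr p \<le> s powr 1"
      using that assms by (intro powr_mono') auto
    then show ?thesis
      using that by (simp add: powr_mult mult_right_mono)
  qed
  consider "x = 0" | "y = 0" | "x > 0" "y > 0"
    using xy by fastforce
  then show "((1 - t) *\<^sub>R x + t *\<^sub>R y) powr p \<le> (1 - t) * x powr p + t * y powr p"
  proof cases
    case 1
    then show ?thesis using zero[of t y] t xy by simp
  next
    case 2
    then show ?thesis using zero[of "1 - t" x] t xy by simp
  next
    case 3
    then show ?thesis
      using convex_onD[OF powr_convex[OF assms], of t x y] t by simp
  qed
qed auto

lemma convex_on_norm_powr:
  assumes "(p::real) \<ge> 1"
  shows "convex_on UNIV (\<lambda>y::'a::real_normed_vector. norm y powr p)"
proof (rule convex_onI)
  fix t :: real and x y :: 'a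
  assume t: "0 < t" "t < 1"
  have "norm ((1 - t) *\<^sub>R x + t *\<^sub>R y) \<le> (1 - t) * norm x + t * norm y"
    using norm_triangle_ineq[of "(1 - t) *\<^sub>R x" "t *\<^sub>R y"] t by simp
  then have "norm ((1 - t) *\<^sub>R x + t *\<^sub>R y) powr p \<le> ((1 - t) * norm x + t * norm y) powr p"
    using assms by (intro powr_mono2) auto
  also have "\<dots> \<le> (1 - t) * norm x powr p + t * norm y powr p"
    using convex_onD[OF powr_convex_nonneg[OF assms], of t "norm x" "norm y"] t by simp
  finally show "norm ((1 - t) *\<^sub>R x + t *\<^sub>R y) powr p \<le> (1 - t) * norm x powr p + t * norm y powr p" .
qed auto

lemma powr_add_le:
  assumes "(p::real) \<ge> 1" "0 \<le> a" "0 \<le> b"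
  shows "(a + b) powr p \<le> 2 powr p * (a powr p + b powr p)"
proof -
  have "(a + b) powr p \<le> (2 * max a b) powr p"
    using assms by (intro powr_mono2) auto
  also have "\<dots> = 2 powr p * max a b powr p"
    using assms by (simp add: powr_mult)
  also have "\<dots> \<le> 2 powr p * (a powr p + b powr p)"
    by (intro mult_left_mono) (auto simp: max_def)
  finally show ?thesis .
qed

subsection \<open>Weak neighbourhoods of zero\<close>

lemma UNIV_weak_nbhds0: "UNIV \<in> weak_nbhds0"
  unfolding weak_nbhds0_def by (auto intro!: exI[of _ "{}"] exI[of _ "1::real"])

lemma zero_in_weak_nbhds0: "U \<in> weak_nbhds0 \<Longrightarrow> 0 \<in> U"
  unfolding weak_nbhds0_def by (auto simp: subset_iff linear_simps)

lemma weak_nbhds0_mono: "U \<in> weak_nbhds0 \<Longrightarrow> U \<subseteq> V \<Longrightarrow> V \<in> weak_nbhds0"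
  unfolding weak_nbhds0_def by blast

lemma weak_nbhds0_Int:
  assumes "U \<in> weak_nbhds0" "V \<in> weak_nbhds0"
  shows "U \<inter> V \<in> weak_nbhds0"
proof -
  obtain S and e :: real where S: "finite S" "\<forall>f\<in>S. bounded_linear f" "e > 0" "{x. \<forall>f\<in>S. \<bar>f x\<bar> < e} \<subseteq> U"
    using assms(1) unfolding weak_nbhds0_def by auto
  obtain S' and e' :: real where S': "finite S'" "\<forall>f\<in>S'. bounded_linear f" "e' > 0" "{x. \<forall>f\<in>S'. \<bar>f x\<bar> < e'} \<subseteq> V"
    using assms(2) unfolding weak_nbhds0_def by auto
  have "{x. \<forall>f\<in>S \<union> S'. \<bar>f x\<bar> < min e e'} \<subseteq> U \<inter> V"
    using S(4) S'(4) by auto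
  then show ?thesis
    unfolding weak_nbhds0_def using S S' by (auto intro!: exI[of _ "S \<union> S'"] exI[of _ "min e e'"])
qed

lemma weak_nbhds0_Inter:
  assumes "finite I" "\<And>i. i \<in> I \<Longrightarrow> U i \<in> weak_nbhds0"
  shows "(\<Inter>i\<in>I. U i) \<in> weak_nbhds0"
  using assms by (induction I rule: finite_induct) (auto simp: UNIV_weak_nbhds0 weak_nbhds0_Int)

text \<open>Functionals pull back to functionals. Applied to dilations, this moves between balls of
  different radii; applied to unimodular scalars, it gives the symmetry of the game.\<close>

lemma weak_nbhds0_vimage:
  assumes "bounded_linear T" "U \<in> weak_nbhds0"
  shows "T -` U \<in> weak_nbhds0"
proof -
  obtain S and e :: real where S: "finite S" "\<forall>f\<in>S. bounded_linear f" "e > 0" "{x. \<forall>f\<in>S. \<bar>f x\<bar> < e} \<subseteq> U"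
    using assms(2) unfolding weak_nbhds0_def by auto
  have "{x. \<forall>f\<in>(\<lambda>f. f \<circ> T) ` S. \<bar>f x\<bar> < e} \<subseteq> T -` U"
    using S(4) by auto
  moreover have "\<forall>f\<in>(\<lambda>f. f \<circ> T) ` S. bounded_linear f"
    using S(2) assms(1) by (auto simp: comp_def intro: bounded_linear_compose)
  ultimately show ?thesis
    unfolding weak_nbhds0_def using S(1,3) by blast
qed

lemma weakly_null_net_eventually_in:
  assumes "weakly_null_net F" "U \<in> weak_nbhds0"
  shows "eventually (\<lambda>x. x \<in> U) F"
proof -
  obtain S and e :: real where S: "finite S" "\<forall>f\<in>S. bounded_linear f" "e > 0" "{x. \<forall>f\<in>S. \<bar>f x\<bar> < e} \<subseteq> U"
    using assms(2) unfolding weak_nbhds0_def by auto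
  have "eventually (\<lambda>x. \<forall>f\<in>S. \<bar>f x\<bar> < e) F"
    using assms(1) S(2,3)
    by (intro eventually_ball_finite S(1)) (auto simp: weakly_null_net_def tendsto_iff)
  then show ?thesis
    by (rule eventually_mono) (use S(4) in auto)
qed

text \<open>This is the coarsest weakly null net in the ball, so bounding the modulus bounds the
  perturbed norm on an entire weak neighbourhood.\<close>

lemma weakly_null_ball_filter:
  assumes "0 \<le> (\<sigma>::real)"
  obtains F :: "'a::real_normed_vector filter" where
    "weakly_null_net F" "eventually (\<lambda>x. norm x \<le> \<sigma>) F"
    "\<And>P. eventually P F \<Longrightarrow> {x. norm x \<le> \<sigma> \<longrightarrow> P x} \<in> weak_nbhds0"
proof -
  define F :: "'a filter" where "F = Abs_filter (\<lambda>P. {x. norm x \<le> \<sigma> \<longrightarrow> P x} \<in> weak_nbhds0)"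
  have "is_filter (\<lambda>P. {x::'a. norm x \<le> \<sigma> \<longrightarrow> P x} \<in> weak_nbhds0)"
  proof
    fix P Q :: "'a \<Rightarrow> bool" assume "{x::'a. norm x \<le> \<sigma> \<longrightarrow> P x} \<in> weak_nbhds0" "{x. norm x \<le> \<sigma> \<longrightarrow> Q x} \<in> weak_nbhds0"
    from weak_nbhds0_Int[OF this] show "{x. norm x \<le> \<sigma> \<longrightarrow> P x \<and> Q x} \<in> weak_nbhds0"
      by (rule weak_nbhds0_mono) auto
  next
    fix P Q :: "'a \<Rightarrow> bool" assume "\<forall>x. P x \<longrightarrow> Q x" "{x::'a. norm x \<le> \<sigma> \<longrightarrow> P x} \<in> weak_nbhds0"
    then show "{x. norm x \<le> \<sigma> \<longrightarrow> Q x} \<in> weak_nbhds0"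
      by (elim weak_nbhds0_mono) auto
  qed (auto simp: UNIV_weak_nbhds0)
  then have ev: "eventually P F \<longleftrightarrow> {x. norm x \<le> \<sigma> \<longrightarrow> P x} \<in> weak_nbhds0" for P
    unfolding F_def by (rule eventually_Abs_filter)
  \<comment> \<open>The origin lies in every weak neighbourhood and, as
    \<open>0 \<le> \<sigma>\<close>, in the ball.\<close>
  have "F \<noteq> bot"
  proof
    assume "F = bot"
    then have "eventually (\<lambda>x. False) F" by simp
    then show False using ev zero_in_weak_nbhds0 assms by fastforce
  qed
  moreover have "(f \<longlongrightarrow> 0) F" if "bounded_linear f" for f :: "'a \<Rightarrow> real"
  proof (rule tendstoI)
    fix e :: real assume "e > 0"
    then have "{x. \<bar>f x\<bar> < e} \<in> weak_nbhds0"
      unfolding weak_nbhds0_def using that by (auto intro!: exI[of _ "{f}"] exI[of _ e])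
    then show "eventually (\<lambda>x. dist (f x) 0 < e) F"
      unfolding ev by (rule weak_nbhds0_mono) auto
  qed
  ultimately have "weakly_null_net F" by (auto simp: weakly_null_net_def)
  moreover have "eventually (\<lambda>x. norm x \<le> \<sigma>) F" by (simp add: ev UNIV_weak_nbhds0)
  ultimately show ?thesis using that ev by blast
qed

subsection \<open>Gauges\<close>

text \<open>The Minkowski functional. Invariance of \<open>B\<close> under unimodular scalars enters
  only when the gauge is shown to be a norm over \<open>K\<close>.\<close>

definition gauge_norm :: "'b::real_vector set \<Rightarrow> 'b \<Rightarrow> real" where
  "gauge_norm B y = Inf {s. 0 < s \<and> y /\<^sub>R s \<in> B}"

locale convex_body =
  fixes B :: "'b::real_normed_vector set" and r R :: real
  assumes conv: "convex B"
    and r_pos: "0 < r"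
    and inner: "\<And>y. norm y \<le> r \<Longrightarrow> y \<in> B"
    and outer: "\<And>y. y \<in> B \<Longrightarrow> norm y \<le> R"
begin

lemma gauge_norm_le: "0 < s \<Longrightarrow> y /\<^sub>R s \<in> B \<Longrightarrow> gauge_norm B y \<le> s"
  unfolding gauge_norm_def by (rule cInf_lower) (auto intro!: bdd_belowI[of _ 0])

text \<open>As \<open>B\<close> may fail to be closed, gauge at most 1 does not give membership; the
  later arguments therefore use a strictly larger \<open>s\<close> and let it decrease. Membership
  propagates from a smaller \<open>q\<close> to \<open>s\<close> along the segment to 0.\<close>

lemma gauge_norm_less_imp:
  assumes "gauge_norm B y < s"
  shows "0 < s" "y /\<^sub>R s \<in> B"
proof -
  define q0 where "q0 = (norm y + 1) / r"
  have q0: "q0 > 0" "norm y \<le> r * q0"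
    using r_pos by (simp_all add: q0_def add_nonneg_pos)
  then have "norm (y /\<^sub>R q0) \<le> r"
    by (simp add: pos_divide_le_eq flip: divide_inverse_commute)
  with q0(1)
  have "{s. 0 < s \<and> y /\<^sub>R s \<in> B} \<noteq> {}"
    using inner by blast
  with assms obtain q where q: "0 < q" "y /\<^sub>R q \<in> B" "q < s"
    unfolding gauge_norm_def by (metis (mono_tags, lifting) cInf_lessD mem_Collect_eq)
  then show "0 < s" by simp
  have "(1 - q / s) *\<^sub>R 0 + (q / s) *\<^sub>R (y /\<^sub>R q) \<in> B"
    using q inner[of 0] r_pos by (intro convexD_alt[OF conv]) auto
  then show "y /\<^sub>R s \<in> B"
    using q by (simp add: field_simps)
qed

lemma gauge_norm_nonneg: "0 \<le> gauge_norm B y"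
  using gauge_norm_less_imp(1)[of y] by (meson less_le_not_le linorder_le_less_linear dense)

lemma gauge_norm_triangle: "gauge_norm B (y + z) \<le> gauge_norm B y + gauge_norm B z"
proof (rule field_le_epsilon)
  fix e :: real assume e: "0 < e"
  define s t where "s = gauge_norm B y + e / 2" and "t = gauge_norm B z + e / 2"
  have s: "0 < s" "y /\<^sub>R s \<in> B" and t: "0 < t" "z /\<^sub>R t \<in> B"
    using gauge_norm_less_imp[of y s] gauge_norm_less_imp[of z t] e by (auto simp: s_def t_def)
  have "(1 - t / (s + t)) *\<^sub>R (y /\<^sub>R s) + (t / (s + t)) *\<^sub>R (z /\<^sub>R t) \<in> B"
    using s t by (intro convexD_alt[OF conv]) auto
  moreover have "1 - t / (s + t) = s / (s + t)"
    using s t by (simp add: field_simps)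
  ultimately have "(y + z) /\<^sub>R (s + t) \<in> B"
    using s t by (simp add: field_simps scaleR_add_right)
  then have "gauge_norm B (y + z) \<le> s + t"
    using s t by (intro gauge_norm_le) auto
  then show "gauge_norm B (y + z) \<le> gauge_norm B y + gauge_norm B z + e"
    by (simp add: s_def t_def)
qed

lemma gauge_norm_lower: "norm y \<le> R * gauge_norm B y"
proof -
  have R: "R \<ge> 0" using outer[of 0] inner[of 0] r_pos by simp
  have "norm y \<le> R * gauge_norm B y + e" if "e > 0" for e
  proof -
    \<comment> \<open>\<open>R\<close> may be 0 in the trivial space, hence the denominator
      \<open>R + 1\<close>.\<close>
    define s where "s = gauge_norm B y + e / (R + 1)"
    have s: "0 < s" "y /\<^sub>R s \<in> B"
      using gauge_norm_less_imp[of y s] that R by (auto simp: s_def)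
    then have "norm y \<le> R * s" using outer[OF s(2)] by (simp add: field_simps)
    also have "\<dots> \<le> R * gauge_norm B y + e"
      using R that by (simp add: s_def field_simps)
    finally show ?thesis .
  qed
  then show ?thesis by (rule field_le_epsilon)
qed

lemma gauge_norm_upper: "gauge_norm B y \<le> norm y / r"
proof (cases "y = 0")
  case True
  have "gauge_norm B y \<le> 0 + e" if "e > 0" for e
    using that inner[of 0] r_pos True by (auto intro: gauge_norm_le)
  then have "gauge_norm B y \<le> 0" by (rule field_le_epsilon)
  with True show ?thesis by simp
next
  case False
  then show ?thesis using r_pos inner by (intro gauge_norm_le) auto
qed

lemma gauge_norm_le_linear_image:
  assumes "linear T" "0 < c" "\<And>y. y \<in> B \<Longrightarrow> T y /\<^sub>R c \<in> B"
  shows "gauge_norm B (T y) \<le> c * gauge_norm B y"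
proof (rule field_le_epsilon)
  fix e :: real assume e: "0 < e"
  define s where "s = gauge_norm B y + e / c"
  have s: "0 < s" "y /\<^sub>R s \<in> B"
    using gauge_norm_less_imp[of y s] e assms by (auto simp: s_def)
  have "gauge_norm B (T y) \<le> c * s"
    using assms(3)[OF s(2)] s assms by (intro gauge_norm_le) (auto simp: linear_scale)
  then show "gauge_norm B (T y) \<le> c * gauge_norm B y + e"
    using assms by (simp add: s_def distrib_left)
qed

end

subsection \<open>Scalars\<close>

text \<open>For \<open>K = \<real>\<close> nothing is known about \<open>J\<close>, not even
  linearity. Proofs about \<open>sc\<close> therefore split: in the real case the term with
  \<open>J\<close> vanishes because its coefficient is 0.\<close>

definition scalar_field :: "complex set \<Rightarrow> ('a::real_normed_vector \<Rightarrow> 'a) \<Rightarrow> bool" where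
  "scalar_field K J \<longleftrightarrow> K = \<real> \<or> K = UNIV \<and> complex_structure J"

lemma norm_sc: "scalar_field K J \<Longrightarrow> c \<in> K \<Longrightarrow> norm (sc J c x) = cmod c * norm x"
  unfolding scalar_field_def complex_structure_def by (auto simp: sc_def elim!: Reals_cases)

lemma bounded_linear_sc:
  assumes "scalar_field K J" "c \<in> K"
  shows "bounded_linear (sc J c)"
proof -
  have "linear (sc J c)"
  proof (cases "K = \<real>")
    case True
    then have "sc J c = (\<lambda>x. Re c *\<^sub>R x)"
      using assms by (auto simp: sc_def elim!: Reals_cases)
    then show ?thesis by simp
  next
    case False
    then have "linear J" using assms by (auto simp: scalar_field_def complex_structure_def)
    then show ?thesis
      unfolding sc_def by (intro linearI) (auto simp: linear_add linear_scale algebra_simps)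
  qed
  moreover have "\<exists>M. \<forall>x. norm (sc J c x) \<le> norm x * M"
    using norm_sc[OF assms] by (metis mult.commute order_refl)
  ultimately show ?thesis
    by (simp add: bounded_linear_def bounded_linear_axioms_def)
qed

lemma sc_mult:
  assumes "scalar_field K J" "c \<in> K" "d \<in> K"
  shows "sc J (c * d) x = sc J c (sc J d x)"
proof (cases "K = \<real>")
  case True
  then show ?thesis using assms by (auto simp: sc_def elim!: Reals_cases)
next
  case False
  then have "linear J" "\<And>x. J (J x) = - x"
    using assms by (auto simp: scalar_field_def complex_structure_def)
  then show ?thesis
    by (simp add: sc_def linear_add linear_scale algebra_simps)
qed

lemma sc_of_real: "sc J (of_real r) x = r *\<^sub>R x"
  by (simp add: sc_def)

lemma scalar_field_divide: "scalar_field K J \<Longrightarrow> c \<in> K \<Longrightarrow> d \<in> K \<Longrightarrow> c / d \<in> K"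
  by (auto simp: scalar_field_def)

lemma scalar_field_of_real: "scalar_field K J \<Longrightarrow> of_real r \<in> K"
  by (auto simp: scalar_field_def)

text \<open>Dividing \<open>c\<close> by its modulus leaves a unimodular scalar, which preserves
  \<open>B\<close>; this gives one inequality in the homogeneity. The other one is the same
  inequality for \<open>1 / c\<close> at the point \<open>sc J c y\<close>.\<close>

lemma (in convex_body) equiv_K_norm_gauge_norm:
  assumes K: "scalar_field K J"
    and bal: "\<And>c y. c \<in> K \<Longrightarrow> cmod c = 1 \<Longrightarrow> y \<in> B \<Longrightarrow> sc J c y \<in> B"
  shows "equiv_K_norm K J (gauge_norm B)"
proof -
  have le: "gauge_norm B (sc J c y) \<le> cmod c * gauge_norm B y" if "c \<in> K" "c \<noteq> 0" for c y
  proof (rule gauge_norm_le_linear_image)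
    show "linear (sc J c)"
      using bounded_linear_sc[OF K that(1)] by (simp add: bounded_linear.linear)
    show "sc J c z /\<^sub>R cmod c \<in> B" if "z \<in> B" for z
    proof -
      have "of_real (inverse (cmod c)) \<in> K" by (rule scalar_field_of_real[OF K])
      then have "sc J c z /\<^sub>R cmod c = sc J (of_real (inverse (cmod c)) * c) z"
        by (simp only: sc_mult[OF K _ \<open>c \<in> K\<close>] sc_of_real)
      moreover have "of_real (inverse (cmod c)) * c \<in> K"
        using scalar_field_divide[OF K \<open>c \<in> K\<close> scalar_field_of_real[OF K, of "cmod c"]]
        by (simp add: field_simps)
      ultimately show ?thesis
        using bal[OF _ _ \<open>z \<in> B\<close>] \<open>c \<noteq> 0\<close> by (simp add: norm_mult norm_inverse)
    qed
  qed (use that in auto)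
  have "gauge_norm B (sc J c y) = cmod c * gauge_norm B y" if c: "c \<in> K" for c y
  proof (cases "c = 0")
    case True
    then show ?thesis
      using gauge_norm_upper[of 0] gauge_norm_nonneg[of 0] by (simp add: sc_def)
  next
    case False
    have inv: "1 / c \<in> K" using scalar_field_divide[OF K _ c, of 1] scalar_field_of_real[OF K, of 1] by simp
    have "gauge_norm B y = gauge_norm B (sc J (1 / c) (sc J c y))"
      using False by (simp flip: sc_mult[OF K inv c]) (simp add: sc_def)
    also have "\<dots> \<le> cmod (1 / c) * gauge_norm B (sc J c y)"
      using False by (intro le inv) auto
    finally have "cmod c * gauge_norm B y \<le> gauge_norm B (sc J c y)"
      using False by (simp add: norm_divide field_simps)
    with le[OF c False, of y] show ?thesis by simp
  qed
  moreover have "y = 0" if "gauge_norm B y = 0" for y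
    using gauge_norm_lower[of y] that by simp
  moreover have "\<exists>a b. 0 < a \<and> 0 < b \<and> (\<forall>y. a * norm y \<le> gauge_norm B y \<and> gauge_norm B y \<le> b * norm y)"
  proof (intro exI conjI allI)
    show "0 < 1 / (\<bar>R\<bar> + 1)" "0 < 1 / r" using r_pos by auto
    show "gauge_norm B y \<le> 1 / r * norm y" for y using gauge_norm_upper[of y] by simp
    have "R * gauge_norm B y \<le> (\<bar>R\<bar> + 1) * gauge_norm B y" for y
      by (intro mult_right_mono gauge_norm_nonneg) auto
    then have "norm y \<le> (\<bar>R\<bar> + 1) * gauge_norm B y" for y
      using gauge_norm_lower[of y] order_trans by blast
    then show "1 / (\<bar>R\<bar> + 1) * norm y \<le> gauge_norm B y" for y
      by (simp add: field_simps)
  qed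
  ultimately show ?thesis
    unfolding equiv_K_norm_def using gauge_norm_nonneg gauge_norm_triangle by blast
qed

subsection \<open>The renorming game\<close>

text \<open>A weakly null perturbation of size \<open>\<sigma>\<close> costs \<open>\<delta> \<sigma>\<close>; \<open>exceeds y c\<close> says that from \<open>y\<close> one
  can reach, frequently along the weak topology, points where \<open>\<phi>\<close> exceeds \<open>c\<close> plus the costs
  paid. The new norm is the gauge of a sublevel set of the value \<open>sup {c. exceeds y c}\<close>, for
  which weakly null perturbations are controlled by construction. A well-founded induction is
  essential: the suprema over games of fixed length do not pass through the upper limits.\<close>

inductive exceeds :: "('b::real_normed_vector \<Rightarrow> real) \<Rightarrow> real set \<Rightarrow> (real \<Rightarrow> real) \<Rightarrow>
    ('a::real_normed_vector \<Rightarrow> 'b) \<Rightarrow> 'b \<Rightarrow> real \<Rightarrow> bool"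
  for \<phi> S \<delta> A where
  base: "c < \<phi> y \<Longrightarrow> exceeds \<phi> S \<delta> A y c"
| step: "\<sigma> \<in> S \<Longrightarrow> \<forall>U\<in>weak_nbhds0. \<exists>x\<in>U. norm x \<le> 1 \<and> exceeds \<phi> S \<delta> A (y + \<sigma> *\<^sub>R A x) (c + \<delta> \<sigma>) \<Longrightarrow>
    exceeds \<phi> S \<delta> A y c"

text \<open>Convexity of the value, stated through levels so that no supremum has to be finite.
  Playing the same \<open>x\<close> from \<open>w\<close>, \<open>y\<close> and \<open>z\<close>
  preserves the convex relation between the positions, and all three levels rise by the same
  cost.\<close>

lemma exceeds_convex:
  assumes "exceeds \<phi> S \<delta> A w e" "w = (1 - t) *\<^sub>R y + t *\<^sub>R z" "e = (1 - t) * c + t * d"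
    and \<phi>: "convex_on UNIV \<phi>" and t: "0 \<le> t" "t \<le> 1"
  shows "exceeds \<phi> S \<delta> A y c \<or> exceeds \<phi> S \<delta> A z d"
  using assms(1-3)
proof (induction arbitrary: y z c d rule: exceeds.induct)
  case (base e w)
  have "\<phi> w \<le> (1 - t) * \<phi> y + t * \<phi> z"
    using convex_onD[OF \<phi>, of t y z] t base by simp
  with base have "\<not> (\<phi> y \<le> c \<and> \<phi> z \<le> d)"
    using t by (smt (verit, best) mult_left_mono)
  then show ?case by (auto intro: exceeds.base)
next
  case (step \<sigma> w e)
  have *: "\<exists>x\<in>U. norm x \<le> 1 \<and>
      (exceeds \<phi> S \<delta> A (y + \<sigma> *\<^sub>R A x) (c + \<delta> \<sigma>) \<or> exceeds \<phi> S \<delta> A (z + \<sigma> *\<^sub>R A x) (d + \<delta> \<sigma>))"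
    if U: "U \<in> weak_nbhds0" for U
  proof -
    obtain x where x: "x \<in> U" "norm x \<le> 1" and
      IH: "\<And>y z c d. w + \<sigma> *\<^sub>R A x = (1 - t) *\<^sub>R y + t *\<^sub>R z \<Longrightarrow> e + \<delta> \<sigma> = (1 - t) * c + t * d \<Longrightarrow>
        exceeds \<phi> S \<delta> A y c \<or> exceeds \<phi> S \<delta> A z d"
      using bspec[OF step.IH U] by blast
    have "exceeds \<phi> S \<delta> A (y + \<sigma> *\<^sub>R A x) (c + \<delta> \<sigma>) \<or> exceeds \<phi> S \<delta> A (z + \<sigma> *\<^sub>R A x) (d + \<delta> \<sigma>)"
      by (rule IH) (simp_all add: step.prems algebra_simps)
    with x show ?thesis by blast
  qed
  show ?case
  \<comment> \<open>A disjunction that holds frequently has a disjunct that holds frequently: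
    otherwise intersect the neighbourhoods on which each of them fails.\<close>
  proof (rule ccontr)
    assume "\<not> ?case"
    then obtain U V where "U \<in> weak_nbhds0" "V \<in> weak_nbhds0"
      "\<And>x. x \<in> U \<Longrightarrow> norm x \<le> 1 \<Longrightarrow> \<not> exceeds \<phi> S \<delta> A (y + \<sigma> *\<^sub>R A x) (c + \<delta> \<sigma>)"
      "\<And>x. x \<in> V \<Longrightarrow> norm x \<le> 1 \<Longrightarrow> \<not> exceeds \<phi> S \<delta> A (z + \<sigma> *\<^sub>R A x) (d + \<delta> \<sigma>)"
      using exceeds.step[OF step.hyps(1), of \<phi> \<delta> A y c] exceeds.step[OF step.hyps(1), of \<phi> \<delta> A z d]
      by blast
    then show False using *[OF weak_nbhds0_Int, of U V] by blast
  qed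
qed

text \<open>An answer in the preimage of \<open>U\<close> under \<open>T'\<close> is carried by
  \<open>T'\<close> to an answer in \<open>U\<close>. With unimodular scalars for \<open>T\<close>
  and \<open>T'\<close> this makes the body of the new norm balanced.\<close>

lemma exceeds_isometry:
  assumes "exceeds \<phi> S \<delta> A y c" and T: "linear T" "\<And>y. \<phi> (T y) = \<phi> y"
    and T': "bounded_linear T'" "\<And>x. norm (T' x) = norm x" and AT: "\<And>x. A (T' x) = T (A x)"
  shows "exceeds \<phi> S \<delta> A (T y) c"
  using assms(1)
proof (induction rule: exceeds.induct)
  case (base c y)
  then show ?case by (auto intro: exceeds.base simp: T)
next
  case (step \<sigma> y c)
  have "\<exists>x\<in>U. norm x \<le> 1 \<and> exceeds \<phi> S \<delta> A (T y + \<sigma> *\<^sub>R A x) (c + \<delta> \<sigma>)" if U: "U \<in> weak_nbhds0" for U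
  proof -
    obtain x where "x \<in> T' -` U" "norm x \<le> 1" "exceeds \<phi> S \<delta> A (T (y + \<sigma> *\<^sub>R A x)) (c + \<delta> \<sigma>)"
      using bspec[OF step.IH weak_nbhds0_vimage[OF T'(1) U]] by blast
    then show ?thesis
      by (intro bexI[of _ "T' x"]) (auto simp: T' AT linear_add[OF T(1)] linear_scale[OF T(1)])
  qed
  then show ?case using step.hyps by (auto intro: exceeds.step)
qed

text \<open>The sets \<open>B\<close> are those obtained by adding the empty tuple to an inevitable set, with
  eventuality weakened to nonemptiness, which is all that is needed to find a bad branch.\<close>

definition witness_tree :: "('b::real_normed_vector \<Rightarrow> real) \<Rightarrow> real set \<Rightarrow> (real \<Rightarrow> real) \<Rightarrow>
    ('a::real_normed_vector \<Rightarrow> 'b) \<Rightarrow> 'b \<Rightarrow> real \<Rightarrow> ('a set list \<Rightarrow> 'a) \<Rightarrow> ('a set list \<Rightarrow> real) \<Rightarrow> bool" where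
  "witness_tree \<phi> S \<delta> A y c x s \<longleftrightarrow>
    normally_weakly_null weak_nbhds0 x \<and> (\<forall>t\<in>tuples weak_nbhds0. norm (x t) \<le> 1) \<and>
    (\<forall>B. [] \<in> B \<longrightarrow> (\<forall>t\<in>B. \<exists>u\<in>weak_nbhds0. t @ [u] \<in> B) \<longrightarrow>
      (\<exists>t\<in>B. (\<forall>i<length t. s (take (Suc i) t) \<in> S) \<and>
        c + (\<Sum>i<length t. \<delta> (s (take (Suc i) t)))
          < \<phi> (y + (\<Sum>i<length t. s (take (Suc i) t) *\<^sub>R A (x (take (Suc i) t))))))"

text \<open>A derivation is a strategy of the player who answers with vectors. Its branches may have
  unbounded lengths, so the bad tuple is located anew in each \<open>B\<close>, by following
  \<open>B\<close> until the strategy ends.\<close>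

lemma exceeds_tree:
  fixes A :: "'a::real_normed_vector \<Rightarrow> 'b::real_normed_vector"
  assumes "exceeds \<phi> S \<delta> A y c"
  shows "\<exists>x s. witness_tree \<phi> S \<delta> A y c x s"
  using assms
proof (induction rule: exceeds.induct)
  case (base c y)
  \<comment> \<open>The game is over here: the empty tuple is already bad, and zero vectors fill the
    rest of the tree.\<close>
  have "normally_weakly_null weak_nbhds0 (\<lambda>_. 0::'a)"
    unfolding normally_weakly_null_def tuples_def using zero_in_weak_nbhds0 last_in_set by blast
  with base show ?case
    by (intro exI[of _ "\<lambda>_. 0"]) (auto simp: witness_tree_def intro!: bexI[of _ "[]"])
next
  case (step \<sigma> y c)
  have "\<forall>u\<in>weak_nbhds0. \<exists>x0 x s. x0 \<in> u \<and> norm x0 \<le> 1 \<and> witness_tree \<phi> S \<delta> A (y + \<sigma> *\<^sub>R A x0) (c + \<delta> \<sigma>) x s"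
    using step.IH by blast
  then obtain x0 X s0 where x0: "\<And>u. u \<in> weak_nbhds0 \<Longrightarrow> x0 u \<in> u \<and> norm (x0 u) \<le> 1"
    and P: "\<And>u. u \<in> weak_nbhds0 \<Longrightarrow> witness_tree \<phi> S \<delta> A (y + \<sigma> *\<^sub>R A (x0 u)) (c + \<delta> \<sigma>) (X u) (s0 u)"
    by metis
  \<comment> \<open>A tuple of length one gets the first answer; a longer one is passed, without its
    head \<open>u\<close>, to the tree chosen for the position after the answer to
    \<open>u\<close>.\<close>
  define x where "x t = (if tl t = [] then x0 (hd t) else X (hd t) (tl t))" for t
  define s where "s t = (if tl t = [] then \<sigma> else s0 (hd t) (tl t))" for t
  have "x t \<in> last t \<and> norm (x t) \<le> 1" if t: "t \<in> tuples weak_nbhds0" for t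
  proof -
    obtain u t' where ut: "t = u # t'" using t by (cases t) (auto simp: tuples_def)
    then have u: "u \<in> weak_nbhds0" using t by (simp add: tuples_def)
    show ?thesis
    proof (cases "t' = []")
      case True
      then show ?thesis using x0[OF u] by (simp add: x_def ut)
    next
      case False
      then have "t' \<in> tuples weak_nbhds0" using t by (simp add: tuples_def ut)
      then show ?thesis
        using False P[OF u] by (simp add: x_def ut witness_tree_def normally_weakly_null_def)
    qed
  qed
  moreover have "\<exists>t\<in>B. (\<forall>i<length t. s (take (Suc i) t) \<in> S) \<and>
      c + (\<Sum>i<length t. \<delta> (s (take (Suc i) t)))
        < \<phi> (y + (\<Sum>i<length t. s (take (Suc i) t) *\<^sub>R A (x (take (Suc i) t))))"
    if B: "[] \<in> B" "\<forall>t\<in>B. \<exists>u\<in>weak_nbhds0. t @ [u] \<in> B" for B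
  proof -
    obtain u where u: "u \<in> weak_nbhds0" "[u] \<in> B" using B by fastforce
    \<comment> \<open>The section of \<open>B\<close> above \<open>u\<close> can again always be
      extended, and it contains the empty tuple because \<open>[u]\<close> is in
      \<open>B\<close>.\<close>
    define B' where "B' = {t. u # t \<in> B}"
    have "\<exists>v\<in>weak_nbhds0. t @ [v] \<in> B'" if "t \<in> B'" for t
      using bspec[OF B(2), of "u # t"] that by (simp add: B'_def)
    moreover have "[] \<in> B'" using u(2) by (simp add: B'_def)
    ultimately have "\<exists>t\<in>B'. (\<forall>i<length t. s0 u (take (Suc i) t) \<in> S) \<and>
        c + \<delta> \<sigma> + (\<Sum>i<length t. \<delta> (s0 u (take (Suc i) t)))
          < \<phi> (y + \<sigma> *\<^sub>R A (x0 u) + (\<Sum>i<length t. s0 u (take (Suc i) t) *\<^sub>R A (X u (take (Suc i) t))))"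
      using P[OF u(1), unfolded witness_tree_def, THEN conjunct2, THEN conjunct2, THEN spec, of B'] by simp
    then obtain t where t: "u # t \<in> B" "\<forall>i<length t. s0 u (take (Suc i) t) \<in> S"
      "c + \<delta> \<sigma> + (\<Sum>i<length t. \<delta> (s0 u (take (Suc i) t)))
          < \<phi> (y + \<sigma> *\<^sub>R A (x0 u) + (\<Sum>i<length t. s0 u (take (Suc i) t) *\<^sub>R A (X u (take (Suc i) t))))"
      by (auto simp: B'_def)
    have shift: "s (take (Suc (Suc i)) (u # t)) = s0 u (take (Suc i) t)"
      "x (take (Suc (Suc i)) (u # t)) = X u (take (Suc i) t)" if "i < length t" for i
      using that by (auto simp: s_def x_def)
    have zero: "s (take (Suc 0) (u # t)) = \<sigma>" "x (take (Suc 0) (u # t)) = x0 u"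
      by (auto simp: s_def x_def)
    have "s (take (Suc i) (u # t)) \<in> S" if "i < length (u # t)" for i
      using that t(2) step.hyps shift(1)[of "i - 1"] zero(1) by (cases i) (simp_all del: take_Suc_Cons)
    moreover have "(\<Sum>i<length (u # t). \<delta> (s (take (Suc i) (u # t)))) =
        \<delta> \<sigma> + (\<Sum>i<length t. \<delta> (s0 u (take (Suc i) t)))"
      unfolding length_Cons sum.lessThan_Suc_shift zero by (simp add: shift del: take_Suc_Cons)
    moreover have "(\<Sum>i<length (u # t). s (take (Suc i) (u # t)) *\<^sub>R A (x (take (Suc i) (u # t)))) =
        \<sigma> *\<^sub>R A (x0 u) + (\<Sum>i<length t. s0 u (take (Suc i) t) *\<^sub>R A (X u (take (Suc i) t)))"
      unfolding length_Cons sum.lessThan_Suc_shift zero by (simp add: shift del: take_Suc_Cons)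
    ultimately show ?thesis
      using t(1,3) by (intro bexI[of _ "u # t"]) (simp_all only: add.assoc, blast)
  qed
  ultimately show ?case
    unfolding witness_tree_def normally_weakly_null_def by blast
qed

lemma eventualD:
  assumes "eventual D D0"
  obtains u where "u \<in> D" "\<And>v. v \<in> D \<Longrightarrow> v \<subseteq> u \<Longrightarrow> v \<in> D0"
  using assms unfolding eventual_def by blast

text \<open>An inevitable set of good tuples, with the empty tuple adjoined, must contain a bad
  tuple of any witness tree. For a nonempty one, the tree estimate with the sizes \<open>s\<close>
  as coefficients makes \<open>bound\<close> applicable, so the costs cover the growth of
  \<open>\<phi>\<close>; the empty one is excluded by \<open>\<phi> y \<le> c\<close>.\<close>

lemma upper_tree_est_not_exceeds:
  assumes ute: "upper_tree_est K JX A C ph" and A: "linear A" and K: "scalar_field K JX"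
    and c: "\<phi> y \<le> c"
    and bound: "\<And>n s z. 0 < n \<Longrightarrow> \<forall>i<n. s i \<in> S \<Longrightarrow> norm z \<le> C * ph (\<lambda>i. complex_of_real (s i)) n \<Longrightarrow>
      \<phi> (y + z) \<le> c + (\<Sum>i<n. \<delta> (s i))"
  shows "\<not> exceeds \<phi> S \<delta> A y c"
proof
  assume "exceeds \<phi> S \<delta> A y c"
  from exceeds_tree[OF this] obtain x s where "witness_tree \<phi> S \<delta> A y c x s" by blast
  then have x: "normally_weakly_null weak_nbhds0 x"
      "\<forall>t\<in>tuples weak_nbhds0. norm (x t) \<le> 1"
    and bad: "\<And>B. [] \<in> B \<Longrightarrow> \<forall>t\<in>B. \<exists>u\<in>weak_nbhds0. t @ [u] \<in> B \<Longrightarrow>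
      \<exists>t\<in>B. (\<forall>i<length t. s (take (Suc i) t) \<in> S) \<and>
        c + (\<Sum>i<length t. \<delta> (s (take (Suc i) t)))
          < \<phi> (y + (\<Sum>i<length t. s (take (Suc i) t) *\<^sub>R A (x (take (Suc i) t))))"
    unfolding witness_tree_def by blast+
  define G where "G = {t \<in> tuples weak_nbhds0. \<forall>a. (\<forall>i. a i \<in> K) \<longrightarrow>
           norm (A (\<Sum>i<length t. sc JX (a i) (x (take (Suc i) t)))) \<le> C * ph a (length t)}"
  obtain B where B: "B \<subseteq> G" "inevitable weak_nbhds0 B"
    using ute x unfolding upper_tree_est_def big_def G_def by blast
  have "\<exists>u\<in>weak_nbhds0. t @ [u] \<in> insert [] B" if "t \<in> insert [] B" for t
  proof -
    have "eventual weak_nbhds0 {u \<in> weak_nbhds0. t @ [u] \<in> B}"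
      using B(2) that by (auto simp: inevitable_def)
    then show ?thesis by (rule eventualD) blast
  qed
  with bad[of "insert [] B"] obtain t where t: "t \<in> insert [] B" "\<forall>i<length t. s (take (Suc i) t) \<in> S"
      "c + (\<Sum>i<length t. \<delta> (s (take (Suc i) t)))
          < \<phi> (y + (\<Sum>i<length t. s (take (Suc i) t) *\<^sub>R A (x (take (Suc i) t))))"
    by blast
  show False
  proof (cases "t = []")
    case True
    then show False using t(3) c by simp
  next
    case False
    then have "t \<in> G" using t(1) B(1) by auto
    then have "norm (A (\<Sum>i<length t. sc JX (complex_of_real (s (take (Suc i) t))) (x (take (Suc i) t))))
        \<le> C * ph (\<lambda>i. complex_of_real (s (take (Suc i) t))) (length t)"
      using scalar_field_of_real[OF K] by (auto simp: G_def)
    then have "norm (\<Sum>i<length t. s (take (Suc i) t) *\<^sub>R A (x (take (Suc i) t)))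
        \<le> C * ph (\<lambda>i. complex_of_real (s (take (Suc i) t))) (length t)"
      by (simp add: sc_of_real linear_sum[OF A] linear_scale[OF A])
    from bound[OF _ t(2) this] t(3) False show False by simp
  qed
qed

section \<open>The norm defined by the game\<close>

lemma Limsup_minus_one_le:
  assumes "\<And>e::real. 0 < e \<Longrightarrow> eventually (\<lambda>x. f x \<le> 1 + r + e) F"
  shows "Limsup F (\<lambda>x. ereal (f x)) - 1 \<le> ereal r"
proof -
  have "Limsup F (\<lambda>x. ereal (f x)) \<le> ereal (1 + r) + ereal e" if "0 < e" for e
    by (rule Limsup_bounded, rule eventually_mono[OF assms[OF that]]) simp
  then have "Limsup F (\<lambda>x. ereal (f x)) \<le> ereal (1 + r)"
    by (rule ereal_le_epsilon2)
  then have "Limsup F (\<lambda>x. ereal (f x)) - 1 \<le> ereal (1 + r) - 1"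
    by (rule ereal_minus_mono) simp
  then show ?thesis by (simp add: one_ereal_def)
qed

text \<open>\<open>T\<close> is the level that defines the body, \<open>r\<close> and
  \<open>R\<close> are its inner and outer radii, and \<open>c0\<close> is a strictly lower level
  that is not exceeded at the origin; the gap \<open>T - c0\<close> turns an additive cost into a
  dilation.\<close>

lemma renorming:
  fixes A :: "'a::real_normed_vector \<Rightarrow> 'b::real_normed_vector"
  assumes A: "linear A" and KX: "scalar_field K JX" and KY: "scalar_field K JY"
    and comm: "\<And>c x. c \<in> K \<Longrightarrow> A (sc JX c x) = sc JY c (A x)"
    and \<phi>: "convex_on UNIV \<phi>" "\<And>c y. c \<in> K \<Longrightarrow> cmod c = 1 \<Longrightarrow> \<phi> (sc JY c y) = \<phi> y"
    and r: "0 < r" "\<And>y. norm y \<le> r \<Longrightarrow> \<not> exceeds \<phi> S \<delta> A y T"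
    and R: "\<And>y. \<phi> y \<le> T \<Longrightarrow> norm y \<le> R"
    and c0: "c0 < T" "\<not> exceeds \<phi> S \<delta> A 0 c0"
    and S: "\<And>\<sigma>. \<sigma> \<in> S \<Longrightarrow> 0 < \<sigma> \<and> 0 \<le> \<delta> \<sigma>"
  shows "\<exists>N. equiv_K_norm K JY N \<and> (\<forall>\<sigma>\<in>S. aus_mod N A \<sigma> \<le> ereal (\<delta> \<sigma> / (T - c0)))"
proof -
  define B where "B = {y. \<not> exceeds \<phi> S \<delta> A y T}"
  interpret convex_body B r R
  proof
    show "convex B"
    proof (rule convexI)
      fix y z and u v :: real
      assume "y \<in> B" "z \<in> B" "0 \<le> u" "0 \<le> v" "u + v = 1"
      moreover have "u = 1 - v" using \<open>u + v = 1\<close> by simp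
      moreover have "T = (1 - v) * T + v * T" by (simp add: algebra_simps)
      ultimately show "u *\<^sub>R y + v *\<^sub>R z \<in> B"
        using exceeds_convex[OF _ refl, of \<phi> S \<delta> A v y z T T T] \<phi>(1) by (auto simp: B_def)
    qed
    show "norm y \<le> R" if "y \<in> B" for y
      using that exceeds.base[of T \<phi> y S \<delta> A] R[of y] by (force simp: B_def)
  qed (use r in \<open>auto simp: B_def\<close>)
  have "sc JY c y \<in> B" if c: "c \<in> K" "cmod c = 1" and y: "y \<in> B" for c y
  proof -
    have inv: "1 / c \<in> K" "cmod (1 / c) = 1"
      using scalar_field_divide[OF KY _ c(1), of 1] scalar_field_of_real[OF KY, of 1] c
      by (simp_all add: norm_divide)
    have "exceeds \<phi> S \<delta> A (sc JY (1 / c) (sc JY c y)) T" if "exceeds \<phi> S \<delta> A (sc JY c y) T"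
      using bounded_linear_sc[OF KY inv(1)] bounded_linear_sc[OF KX inv(1)] inv
      by (intro exceeds_isometry[OF that, where T' = "sc JX (1 / c)"] \<phi>)
        (auto simp: norm_sc[OF KX] comm bounded_linear.linear)
    moreover have "sc JY (1 / c) (sc JY c y) = y"
      using c by (subst sc_mult[OF KY inv(1) c(1), symmetric]) (auto simp: sc_def)
    ultimately show ?thesis using y by (auto simp: B_def)
  qed
  then have "equiv_K_norm K JY (gauge_norm B)"
    by (intro equiv_K_norm_gauge_norm KY)
  moreover have "aus_mod (gauge_norm B) A \<sigma> \<le> ereal (\<delta> \<sigma> / (T - c0))" if \<sigma>: "\<sigma> \<in> S" for \<sigma>
  proof (cases "A = (\<lambda>_. 0)")
    case True
    then show ?thesis using S[OF \<sigma>] c0 by (simp add: aus_mod_def)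
  next
    case False
    \<comment> \<open>Chosen so that with \<open>t = 1 / (1 + \<eta>)\<close> the levels
      \<open>c0\<close> at 0 and \<open>T + \<delta> \<sigma>\<close> at \<open>z\<close> average to
      exactly \<open>T\<close>.\<close>
    define \<eta> where "\<eta> = \<delta> \<sigma> / (T - c0)"
    have \<eta>: "0 \<le> \<eta>" using S[OF \<sigma>] c0 by (simp add: \<eta>_def)
    have scaled: "z /\<^sub>R (1 + \<eta>) \<in> B" if "\<not> exceeds \<phi> S \<delta> A z (T + \<delta> \<sigma>)" for z
    proof -
      define t where "t = 1 / (1 + \<eta>)"
      have t: "0 \<le> t" "t \<le> 1" "t * (1 + \<eta>) = 1" using \<eta> by (auto simp: t_def)
      have \<delta>: "\<delta> \<sigma> = \<eta> * (T - c0)" using c0 by (simp add: \<eta>_def)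
      have "(1 - t) * c0 + t * (T + \<delta> \<sigma>) = c0 + (t * (1 + \<eta>)) * (T - c0)"
        unfolding \<delta> by (simp add: algebra_simps)
      then have "T = (1 - t) * c0 + t * (T + \<delta> \<sigma>)"
        using t(3) by simp
      moreover have "z /\<^sub>R (1 + \<eta>) = (1 - t) *\<^sub>R 0 + t *\<^sub>R z"
        by (simp add: t_def inverse_eq_divide)
      ultimately show ?thesis
        using exceeds_convex[of \<phi> S \<delta> A "z /\<^sub>R (1 + \<eta>)" T t 0 z c0 "T + \<delta> \<sigma>"] t \<phi>(1) that c0(2)
        unfolding B_def by blast
    qed
    have "Limsup F (\<lambda>x. ereal (gauge_norm B (y + A x))) - 1 \<le> ereal \<eta>"
      if y: "gauge_norm B y \<le> 1" and F: "weakly_null_net F" "eventually (\<lambda>x. norm x \<le> \<sigma>) F" for y F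
    proof (rule Limsup_minus_one_le)
      fix e :: real assume e: "0 < e"
      \<comment> \<open>Since \<open>s\<close> exceeds 1, \<open>y /\<^sub>R s\<close> is in
        \<open>B\<close> even when \<open>y\<close> is not, and \<open>s * (1 + \<eta>)\<close>
        equals \<open>1 + \<eta> + e\<close>.\<close>
      define s where "s = 1 + e / (1 + \<eta>)"
      have s: "1 < s" using e \<eta> by (simp add: s_def)
      have "y /\<^sub>R s \<in> B" using y s by (intro gauge_norm_less_imp) auto
      then obtain U where U: "U \<in> weak_nbhds0"
        "\<And>x. x \<in> U \<Longrightarrow> norm x \<le> 1 \<Longrightarrow> \<not> exceeds \<phi> S \<delta> A (y /\<^sub>R s + \<sigma> *\<^sub>R A x) (T + \<delta> \<sigma>)"
        using exceeds.step[OF \<sigma>, of \<phi> \<delta> A "y /\<^sub>R s" T] by (auto simp: B_def)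
      have "eventually (\<lambda>x. x \<in> (*\<^sub>R) (1 / (s * \<sigma>)) -` U) F"
        using U(1) by (intro weakly_null_net_eventually_in F weak_nbhds0_vimage bounded_linear_scaleR_right)
      then show "eventually (\<lambda>x. gauge_norm B (y + A x) \<le> 1 + \<eta> + e) F"
        using F(2)
      proof eventually_elim
        case (elim x)
        have \<sigma>0: "0 < \<sigma>" using S[OF \<sigma>] by simp
        have "norm x \<le> s * \<sigma>"
          using elim(2) s \<sigma>0 by (smt (verit) mult_le_cancel_right1)
        then have "norm ((1 / (s * \<sigma>)) *\<^sub>R x) \<le> 1"
          using s \<sigma>0 by simp
        from scaled[OF U(2)[OF _ this]] elim(1)
        have "(y /\<^sub>R s + \<sigma> *\<^sub>R A ((1 / (s * \<sigma>)) *\<^sub>R x)) /\<^sub>R (1 + \<eta>) \<in> B"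
          by simp
        moreover have "y /\<^sub>R s + \<sigma> *\<^sub>R A ((1 / (s * \<sigma>)) *\<^sub>R x) = (y + A x) /\<^sub>R s"
          using \<sigma>0 by (simp add: linear_scale[OF A] scaleR_add_right divide_inverse)
        ultimately have "(y + A x) /\<^sub>R (s * (1 + \<eta>)) \<in> B"
          by (simp add: mult.commute)
        then have "gauge_norm B (y + A x) \<le> s * (1 + \<eta>)"
          using s \<eta> by (intro gauge_norm_le) auto
        also have "\<dots> = 1 + \<eta> + e"
          using \<eta> by (simp add: s_def field_simps)
        finally show ?case .
      qed
    qed
    then show ?thesis
      using False by (auto simp: aus_mod_def \<eta>_def intro!: SUP_least)
  qed
  ultimately show ?thesis by blast
qed

section \<open>Renormings obtained from tree estimates\<close>

lemma equiv_K_norm_scaleR: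
  assumes "equiv_K_norm K J N" "scalar_field K J"
  shows "N (r *\<^sub>R y) = \<bar>r\<bar> * N y"
  using assms(1) scalar_field_of_real[OF assms(2), of r] unfolding equiv_K_norm_def
  by (metis sc_of_real norm_of_real real_norm_def)

text \<open>\<open>AUF\<close> asks for a modulus equal to 0, whereas the renorming only bounds it
  from above. The lower bound comes from the constant net at 0 and a vector of norm 1, which exists
  because \<open>A\<close> is nonzero.\<close>

lemma aus_mod_nonneg:
  fixes A :: "'a::real_normed_vector \<Rightarrow> 'b::real_normed_vector"
  assumes N: "equiv_K_norm K J N" "scalar_field K J" and A: "linear A" and \<sigma>: "0 \<le> \<sigma>"
  shows "0 \<le> aus_mod N A \<sigma>"
proof (cases "A = (\<lambda>_. 0)")
  case False
  then obtain x where "A x \<noteq> 0" by blast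
  define y where "y = A x"
  have "y \<noteq> 0" using \<open>A x \<noteq> 0\<close> by (simp add: y_def)
  have "0 \<le> N y" "N y = 0 \<longrightarrow> y = 0" using N(1) by (auto simp: equiv_K_norm_def)
  with \<open>y \<noteq> 0\<close> have "0 < N y" by (simp add: order_less_le)
  then have "N (y /\<^sub>R N y) = 1" using equiv_K_norm_scaleR[OF N, of "inverse (N y)" y] by simp
  moreover have pr: "weakly_null_net (principal {0::'a})"
    unfolding weakly_null_net_def
    by (simp add: tendsto_iff eventually_principal principal_eq_bot_iff linear_simps(3))
  ultimately have "1 \<le> Limsup (principal {0}) (\<lambda>x. ereal (N (y /\<^sub>R N y + A x)))"
    by (intro le_Limsup)
      (auto simp: eventually_principal principal_eq_bot_iff linear_0[OF A] one_ereal_def)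
  from ereal_minus_mono[OF this order_refl[of 1]]
  have "0 \<le> Limsup (principal {0}) (\<lambda>x. ereal (N (y /\<^sub>R N y + A x))) - 1"
    by (simp add: one_ereal_def)
  then show ?thesis
    using \<sigma> False pr \<open>N (y /\<^sub>R N y) = 1\<close> unfolding aus_mod_def
    by (auto simp: eventually_principal intro!: SUP_upper2[of "(y /\<^sub>R N y, principal {0})"])
qed (simp add: aus_mod_def)

lemma lp_ute_imp_p_AUS_able:
  fixes A :: "'a::real_normed_vector \<Rightarrow> 'b::real_normed_vector"
  assumes A: "linear A" and KX: "scalar_field K JX" and KY: "scalar_field K JY"
    and comm: "\<And>c x. c \<in> K \<Longrightarrow> A (sc JX c x) = sc JY c (A x)"
    and p: "1 < p" and C: "0 < C" and ute: "lp_ute K JX p A C"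
  shows "p_AUS_able K JY p A"
proof -
  \<comment> \<open>The factor \<open>2 powr p\<close> is the constant of
    \<open>powr_add_le\<close>. The level \<open>2 powr p\<close> used for the body cancels it again
    and keeps the unit ball inside.\<close>
  let ?\<delta> = "\<lambda>\<sigma>. 2 powr p * (C powr p * \<sigma> powr p)"
  have not_exceeds: "\<not> exceeds (\<lambda>y. norm y powr p) {0<..} ?\<delta> A y c" if c: "2 powr p * norm y powr p \<le> c" for y c
  proof (rule upper_tree_est_not_exceeds[OF ute[unfolded lp_ute_def] A KX])
    have "1 * norm y powr p \<le> 2 powr p * norm y powr p"
      using p by (intro mult_right_mono ge_one_powr_ge_zero) auto
    then show "norm y powr p \<le> c" using c by simp
    fix n :: nat and s :: "nat \<Rightarrow> real" and z :: 'b
    assume s: "\<forall>i<n. s i \<in> {0<..}"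
      and z: "norm z \<le> C * (\<Sum>i<n. cmod (complex_of_real (s i)) powr p) powr (1 / p)"
    let ?Q = "\<Sum>i<n. s i powr p"
    have Q: "(\<Sum>i<n. cmod (complex_of_real (s i)) powr p) = ?Q"
      using s by (intro sum.cong) auto
    have "norm z powr p \<le> (C * ?Q powr (1 / p)) powr p"
      using z p unfolding Q by (intro powr_mono2) auto
    also have "\<dots> = C powr p * ?Q"
      using C p by (simp add: powr_mult powr_powr sum_nonneg)
    finally have z': "norm z powr p \<le> C powr p * ?Q" .
    have "norm (y + z) powr p \<le> (norm y + norm z) powr p"
      using p by (intro powr_mono2 norm_triangle_ineq) auto
    also have "\<dots> \<le> 2 powr p * (norm y powr p + norm z powr p)"
      using p by (intro powr_add_le) auto
    also have "\<dots> \<le> 2 powr p * (norm y powr p + C powr p * ?Q)"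
      using z' by simp
    also have "\<dots> \<le> c + (\<Sum>i<n. ?\<delta> (s i))"
      using c by (simp add: distrib_left sum_distrib_left)
    finally show "norm (y + z) powr p \<le> c + (\<Sum>i<n. ?\<delta> (s i))" .
  qed
  have "\<exists>N. equiv_K_norm K JY N \<and> (\<forall>\<sigma>\<in>{0<..}. aus_mod N A \<sigma> \<le> ereal (?\<delta> \<sigma> / (2 powr p - 0)))"
  proof (rule renorming[OF A KX KY comm, where \<phi> = "\<lambda>y. norm y powr p" and r = 1 and R = 2])
    show "convex_on UNIV (\<lambda>y::'b. norm y powr p)" using p by (intro convex_on_norm_powr) simp
    show "\<not> exceeds (\<lambda>y. norm y powr p) {0<..} ?\<delta> A y (2 powr p)" if "norm y \<le> 1" for y
      using that p by (intro not_exceeds) (auto intro: powr_le1)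
    show "norm y \<le> 2" if "norm y powr p \<le> 2 powr p" for y :: 'b
      using that p powr_less_mono2[of p 2 "norm y"] by fastforce
  qed (use not_exceeds[of 0 0] p C norm_sc[OF KY] in auto)
  then obtain N where "equiv_K_norm K JY N" "\<And>\<sigma>. 0 < \<sigma> \<Longrightarrow> aus_mod N A \<sigma> \<le> ereal (C powr p * \<sigma> powr p)"
    by auto
  then show ?thesis unfolding p_AUS_able_def p_AUS_def by blast
qed

lemma c0_ute_imp_AUF_able:
  fixes A :: "'a::real_normed_vector \<Rightarrow> 'b::real_normed_vector"
  assumes A: "linear A" and KX: "scalar_field K JX" and KY: "scalar_field K JY"
    and comm: "\<And>c x. c \<in> K \<Longrightarrow> A (sc JX c x) = sc JY c (A x)"
    and C: "0 < C" and ute: "c0_ute K JX A C"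
  shows "AUF_able K JY A"
proof -
  \<comment> \<open>Flatness concerns one \<open>\<sigma>\<close> only, so size 1 suffices. All
    coefficients are then 1, and so is their maximum at every length: the perturbation stays below
    \<open>C\<close> at no cost.\<close>
  have not_exceeds: "\<not> exceeds norm {1} (\<lambda>_. 0) A y c" if c: "norm y + C \<le> c" for y c
  proof (rule upper_tree_est_not_exceeds[OF ute[unfolded c0_ute_def] A KX])
    show "norm y \<le> c" using c C by simp
    fix n :: nat and s :: "nat \<Rightarrow> real" and z :: 'b
    assume n: "0 < n" and s: "\<forall>i<n. s i \<in> {1}"
      and z: "norm z \<le> C * Max ((\<lambda>i. cmod (complex_of_real (s i))) ` {..<n})"
    have "(\<lambda>i. cmod (complex_of_real (s i))) ` {..<n} = {1}"
      using n s by auto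
    then have "norm z \<le> C" using z by simp
    then show "norm (y + z) \<le> c + (\<Sum>i<n. 0)"
      using c norm_triangle_ineq[of y z] by simp
  qed
  \<comment> \<open>The origin does not exceed \<open>C\<close>, and the unit ball does not exceed
    \<open>C + 1\<close>.\<close>
  have "\<exists>N. equiv_K_norm K JY N \<and> (\<forall>\<sigma>\<in>{1}. aus_mod N A \<sigma> \<le> ereal (0 / (C + 1 - C)))"
  proof (rule renorming[OF A KX KY comm, where \<phi> = norm and r = 1 and R = "C + 1"])
    show "\<not> exceeds norm {1} (\<lambda>_. 0) A y (C + 1)" if "norm y \<le> 1" for y
      using that by (intro not_exceeds) simp
    show "\<not> exceeds norm {1} (\<lambda>_. 0) A 0 C" by (intro not_exceeds) simp
  qed (use norm_sc[OF KY] convex_on_dist[of UNIV "0::'b"] in \<open>auto simp: dist_norm\<close>)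
  then obtain N where N: "equiv_K_norm K JY N" "aus_mod N A 1 \<le> 0"
    by (auto simp: zero_ereal_def)
  then have "aus_mod N A 1 = 0"
    using aus_mod_nonneg[OF N(1) KY A, of 1] by simp
  with N show ?thesis unfolding AUF_able_def AUF_def by (meson zero_less_one)
qed

lemma aus_mod_leD:
  fixes A :: "'a::real_normed_vector \<Rightarrow> 'b::real_normed_vector"
  assumes le: "aus_mod N A \<sigma> \<le> ereal r" and r: "0 \<le> r" and \<sigma>: "0 \<le> \<sigma>" and y: "N y \<le> 1" and e: "0 < e"
  shows "\<exists>U\<in>weak_nbhds0. \<forall>x\<in>U. norm x \<le> \<sigma> \<longrightarrow> N (y + A x) \<le> 1 + r + e"
proof (cases "A = (\<lambda>_. 0)")
  case True
  then show ?thesis using UNIV_weak_nbhds0 y r e by force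
next
  case False
  obtain F :: "'a filter" where F: "weakly_null_net F" "eventually (\<lambda>x. norm x \<le> \<sigma>) F"
    "\<And>P. eventually P F \<Longrightarrow> {x. norm x \<le> \<sigma> \<longrightarrow> P x} \<in> weak_nbhds0"
    using weakly_null_ball_filter[OF \<sigma>] by blast
  have "Limsup F (\<lambda>x. ereal (N (y + A x))) - 1 \<le> aus_mod N A \<sigma>"
    using False y F(1,2) unfolding aus_mod_def by (auto intro!: SUP_upper2[of "(y, F)"])
  then have "Limsup F (\<lambda>x. ereal (N (y + A x))) - 1 \<le> ereal r"
    using le by (rule order_trans)
  then have "Limsup F (\<lambda>x. ereal (N (y + A x))) < ereal (1 + r + e)"
    using e by (cases "Limsup F (\<lambda>x. ereal (N (y + A x)))") (auto simp: one_ereal_def)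
  then have "eventually (\<lambda>x. N (y + A x) < 1 + r + e) F"
    using Limsup_lessD by fastforce
  from F(3)[OF this] show ?thesis by (intro bexI) auto
qed

subsection \<open>Upper estimates for coefficient sequences\<close>

text \<open>Both the \<open>l\<^sub>p\<close> norm and the maximum norm arise by iterating a binary operation.\<close>

primrec iter_op :: "(real \<Rightarrow> real \<Rightarrow> real) \<Rightarrow> nat \<Rightarrow> (nat \<Rightarrow> real) \<Rightarrow> real" where
  "iter_op f 0 a = 0"
| "iter_op f (Suc n) a = f (iter_op f n a) \<bar>a n\<bar>"

text \<open>Monotonicity inserts the estimate already obtained, homogeneity extracts the common
  constant, and the last two axioms make the iterate dominate every coefficient, which absorbs
  additive errors.\<close>

locale norm_op =
  fixes f :: "real \<Rightarrow> real \<Rightarrow> real"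
  assumes mono: "0 \<le> a \<Longrightarrow> a \<le> a' \<Longrightarrow> 0 \<le> b \<Longrightarrow> b \<le> b' \<Longrightarrow> f a b \<le> f a' b'"
    and homogeneous: "0 \<le> c \<Longrightarrow> 0 \<le> a \<Longrightarrow> 0 \<le> b \<Longrightarrow> f (c * a) (c * b) = c * f a b"
    and upper1: "0 \<le> a \<Longrightarrow> 0 \<le> b \<Longrightarrow> a \<le> f a b"
    and upper2: "0 \<le> a \<Longrightarrow> 0 \<le> b \<Longrightarrow> b \<le> f a b"
begin

lemma iter_op_nonneg: "0 \<le> iter_op f n a"
  by (induction n) (auto intro: order_trans[OF _ upper1])

lemma abs_le_iter_op: "i < n \<Longrightarrow> \<bar>a i\<bar> \<le> iter_op f n a"
proof (induction n)
  case (Suc n)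
  have "iter_op f n a \<le> iter_op f (Suc n) a" "\<bar>a n\<bar> \<le> iter_op f (Suc n) a"
    using upper1 upper2 iter_op_nonneg by simp_all
  with Suc show ?case by (cases "i = n") auto
qed simp

lemma iter_op_mono:
  "(\<And>i. i < n \<Longrightarrow> \<bar>a i\<bar> \<le> \<bar>b i\<bar>) \<Longrightarrow> iter_op f n a \<le> iter_op f n b"
  by (induction n) (auto intro!: mono iter_op_nonneg)

lemma iter_op_scale: "iter_op f n (\<lambda>i. c * a i) = \<bar>c\<bar> * iter_op f n a"
  by (induction n) (simp_all add: abs_mult homogeneous iter_op_nonneg)

end

lemma norm_op_max: "norm_op max"
  by standard (auto simp: max_def mult_le_cancel_left)

lemma iter_op_max:
  assumes "0 < n"
  shows "iter_op max n a = Max ((\<lambda>i. \<bar>a i\<bar>) ` {..<n})"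
  using assms
proof (induction n rule: nat_induct_non_zero)
  case (Suc n)
  then have "{..<n} \<noteq> {}" by auto
  then show ?case
    using Suc by (simp add: lessThan_Suc max.commute)
qed (simp add: lessThan_Suc)

lemma norm_op_lp:
  assumes p: "1 < (p::real)"
  shows "norm_op (\<lambda>a b. (a powr p + b powr p) powr (1 / p))"
proof
  fix a b c :: real assume nn: "0 \<le> a" "0 \<le> b"
  have "(a powr p) powr (1 / p) \<le> (a powr p + b powr p) powr (1 / p)"
    "(b powr p) powr (1 / p) \<le> (a powr p + b powr p) powr (1 / p)"
    using p by (auto intro!: powr_mono2)
  then show "a \<le> (a powr p + b powr p) powr (1 / p)" "b \<le> (a powr p + b powr p) powr (1 / p)"
    using nn p by (simp_all add: powr_powr)
  assume c: "0 \<le> c"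
  have "(c * a) powr p + (c * b) powr p = c powr p * (a powr p + b powr p)"
    using nn c by (simp add: powr_mult distrib_left)
  then show "((c * a) powr p + (c * b) powr p) powr (1 / p) = c * (a powr p + b powr p) powr (1 / p)"
    using p c by (simp add: powr_mult powr_powr)
next
  fix a a' b b' :: real
  assume "0 \<le> a" "a \<le> a'" "0 \<le> b" "b \<le> b'"
  then show "(a powr p + b powr p) powr (1 / p) \<le> (a' powr p + b' powr p) powr (1 / p)"
    using p by (intro powr_mono2 add_mono) auto
qed

lemma iter_op_lp:
  assumes "1 < (p::real)"
  shows "iter_op (\<lambda>a b. (a powr p + b powr p) powr (1 / p)) n a = (\<Sum>i<n. \<bar>a i\<bar> powr p) powr (1 / p)"
  using assms by (induction n) (simp_all add: powr_powr sum_nonneg)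

lemma truncate_to_grid:
  fixes b :: real and q :: nat
  assumes "\<bar>b\<bar> \<le> 1" "0 < q"
  obtains k :: int where "\<bar>k\<bar> \<le> int q" "\<bar>of_int k / real q\<bar> \<le> \<bar>b\<bar>" "\<bar>b - of_int k / real q\<bar> \<le> 1 / real q"
proof -
  define m where "m = \<lfloor>\<bar>b\<bar> * real q\<rfloor>"
  have m: "0 \<le> m" "of_int m \<le> \<bar>b\<bar> * real q" "\<bar>b\<bar> * real q < of_int m + 1"
    unfolding m_def by (auto simp: of_int_floor_le)
  have "\<bar>b\<bar> * real q \<le> 1 * real q" using assms by (intro mult_right_mono) auto
  then have mq: "m \<le> int q" using m(2) by linarith
  have le: "of_int m / real q \<le> \<bar>b\<bar>" "\<bar>b\<bar> - of_int m / real q \<le> 1 / real q"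
    using m assms divide_right_mono[of "\<bar>b\<bar> * real q - of_int m" 1 "real q"]
    by (simp_all add: pos_divide_le_eq diff_divide_distrib)
  have m0: "0 \<le> of_int m / real q" using m by simp
  show ?thesis
  proof (cases "0 \<le> b")
    case True
    then show ?thesis using m(1) mq le m0 by (intro that[of m]) auto
  next
    case False
    then show ?thesis using m(1) mq le m0 by (intro that[of "- m"]) auto
  qed
qed

text \<open>Rounding the coefficients towards zero on a fine grid reduces the uniform estimate to
  finitely many coefficient vectors and does not increase the right-hand side.\<close>

lemma (in norm_op) extend_estimate:
  fixes A :: "'a::real_normed_vector \<Rightarrow> 'b::real_normed_vector" and xs :: "nat \<Rightarrow> 'a"
  assumes tri: "\<And>y z. N (y + z) \<le> N y + N z" and scale: "\<And>r y. N (r *\<^sub>R y) = \<bar>r\<bar> * N y"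
    and L: "\<And>x. norm x \<le> 1 \<Longrightarrow> N (A x) \<le> L"
    and step: "\<And>y r \<eta>. 0 < \<eta> \<Longrightarrow>
      \<exists>U\<in>weak_nbhds0. \<forall>x\<in>U. norm x \<le> 1 \<longrightarrow> N (y + r *\<^sub>R A x) \<le> f (N y) (C * \<bar>r\<bar>) + \<eta>"
    and nonneg: "\<And>y. 0 \<le> N y"
    and C: "0 \<le> C" "C \<le> c" "c < c'"
    and xs: "\<And>i. i < m \<Longrightarrow> norm (xs i) \<le> 1"
    and est: "\<And>a. N (\<Sum>i<m. a i *\<^sub>R A (xs i)) \<le> c * iter_op f m a"
  shows "\<exists>U\<in>weak_nbhds0. \<forall>x\<in>U. norm x \<le> 1 \<longrightarrow>
    (\<forall>a. N (\<Sum>i<Suc m. a i *\<^sub>R A ((xs(m := x)) i)) \<le> c' * iter_op f (Suc m) a)"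
proof -
  \<comment> \<open>Half of the gap pays for \<open>\<eta>\<close> in the one-step inequality, half
    for rounding.\<close>
  define e where "e = (c' - c) / 2"
  have e: "0 < e" using C by (simp add: e_def)
  have N0: "N 0 = 0" using scale[of 0 0] by simp
  have N_sum: "N (\<Sum>i\<in>I. z i) \<le> (\<Sum>i\<in>I. N (z i))" if "finite I" for I :: "nat set" and z
    using that by (induction I rule: finite_induct) (auto simp: N0 intro: order_trans[OF tri])
  have L0: "0 \<le> L" using order_trans[OF nonneg L[of 0]] by simp
  \<comment> \<open>Each of the \<open>Suc m\<close> coefficients is off by at most
    \<open>1 / q\<close>, against vectors of \<open>N\<close>-norm at most \<open>L\<close>.\<close>
  obtain q :: nat where q: "L * Suc m / e < q" using reals_Archimedean2 by blast
  moreover have "0 \<le> L * Suc m / e" using L0 e by simp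
  ultimately have "0 < real q" by linarith
  then have q0: "0 < q" by simp
  have qe: "L * Suc m / q \<le> e" using q q0 e by (simp add: field_simps)
  define G where "G = ({..m} \<rightarrow>\<^sub>E {- int q..int q})"
  have "finite G" unfolding G_def by (intro finite_PiE) auto
  let ?g = "\<lambda>k i. of_int (k i) / real q"
  define good where "good k x \<longleftrightarrow> N ((\<Sum>i<m. ?g k i *\<^sub>R A (xs i)) + ?g k m *\<^sub>R A x)
      \<le> f (N (\<Sum>i<m. ?g k i *\<^sub>R A (xs i))) (C * \<bar>?g k m\<bar>) + e" for k and x :: 'a
  have "\<exists>U\<in>weak_nbhds0. \<forall>x\<in>U. norm x \<le> 1 \<longrightarrow> good k x" for k :: "nat \<Rightarrow> int"
    unfolding good_def by (rule step[OF e])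
  then obtain U where U: "\<And>k. U k \<in> weak_nbhds0" "\<And>k x. x \<in> U k \<Longrightarrow> norm x \<le> 1 \<Longrightarrow> good k x"
    by metis
  have V: "(\<Inter>k\<in>G. U k) \<in> weak_nbhds0"
    using \<open>finite G\<close> U(1) by (rule weak_nbhds0_Inter)
  have "N (\<Sum>i<Suc m. a i *\<^sub>R A ((xs(m := x)) i)) \<le> c' * iter_op f (Suc m) a"
    if x: "x \<in> (\<Inter>k\<in>G. U k)" "norm x \<le> 1" for x a
  proof -
    let ?ys = "xs(m := x)"
    have ys: "N (A (?ys i)) \<le> L" if "i < Suc m" for i
      using that xs x(2) by (intro L) auto
    \<comment> \<open>If the largest coefficient has modulus 1, the iterate is at least 1, so the
      additive error \<open>2 * e\<close> is at most \<open>c' - c\<close> times the iterate.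
      Homogeneity gives the general case.\<close>
    have unit: "N (\<Sum>i<Suc m. b i *\<^sub>R A (?ys i)) \<le> c' * iter_op f (Suc m) b"
      if b: "\<And>i. i < Suc m \<Longrightarrow> \<bar>b i\<bar> \<le> 1" and j: "j < Suc m" "\<bar>b j\<bar> = 1" for b j
    proof -
      have "\<forall>i. \<exists>k::int. i < Suc m \<longrightarrow> \<bar>k\<bar> \<le> int q \<and> \<bar>of_int k / real q\<bar> \<le> \<bar>b i\<bar> \<and> \<bar>b i - of_int k / real q\<bar> \<le> 1 / real q"
        using b q0 truncate_to_grid by metis
      then obtain k0 :: "nat \<Rightarrow> int" where k0: "\<And>i. i < Suc m \<Longrightarrow> \<bar>k0 i\<bar> \<le> int q \<and> \<bar>of_int (k0 i) / real q\<bar> \<le> \<bar>b i\<bar> \<and> \<bar>b i - of_int (k0 i) / real q\<bar> \<le> 1 / real q"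
        by metis
      \<comment> \<open>\<open>G\<close> consists of extensional functions, which is what makes it
        finite.\<close>
      define k where "k = restrict k0 {..m}"
      have k_eq: "k i = k0 i" if "i < Suc m" for i using that by (simp add: k_def)
      have "- int q \<le> k0 i \<and> k0 i \<le> int q" if "i < Suc m" for i
        using k0[OF that] by linarith
      then have "k \<in> G"
        unfolding G_def k_def restrict_PiE_iff by auto
      then have k: "k \<in> G" "\<And>i. i < Suc m \<Longrightarrow> \<bar>?g k i\<bar> \<le> \<bar>b i\<bar>" "\<And>i. i < Suc m \<Longrightarrow> \<bar>b i - ?g k i\<bar> \<le> 1 / real q"
        using k0 by (simp_all add: k_eq)
      define S where "S = (\<Sum>i<m. ?g k i *\<^sub>R A (xs i))"
      have sumg: "(\<Sum>i<Suc m. ?g k i *\<^sub>R A (?ys i)) = S + ?g k m *\<^sub>R A x"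
        unfolding S_def by simp
      have "N (S + ?g k m *\<^sub>R A x) \<le> f (N S) (C * \<bar>?g k m\<bar>) + e"
        using U(2)[of x k] k(1) x by (simp add: good_def S_def)
      \<comment> \<open>Here \<open>C \<le> c\<close> is used: both arguments must carry the same
        factor before it can be extracted.\<close>
      also have "f (N S) (C * \<bar>?g k m\<bar>) \<le> f (c * iter_op f m (?g k)) (c * \<bar>?g k m\<bar>)"
        using est C unfolding S_def by (intro mono nonneg mult_nonneg_nonneg mult_right_mono) auto
      also have "\<dots> = c * iter_op f (Suc m) (?g k)"
        unfolding iter_op.simps using C by (intro homogeneous iter_op_nonneg) auto
      also have "\<dots> \<le> c * iter_op f (Suc m) b"
        using k C by (intro mult_left_mono iter_op_mono) auto
      finally have 1: "N (\<Sum>i<Suc m. ?g k i *\<^sub>R A (?ys i)) \<le> c * iter_op f (Suc m) b + e"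
        unfolding sumg by simp
      have "(\<Sum>i<Suc m. b i *\<^sub>R A (?ys i)) = (\<Sum>i<Suc m. ?g k i *\<^sub>R A (?ys i)) + (\<Sum>i<Suc m. (b i - ?g k i) *\<^sub>R A (?ys i))"
        unfolding sum.distrib[symmetric] by (intro sum.cong) (auto simp: scaleR_diff_left)
      then have "N (\<Sum>i<Suc m. b i *\<^sub>R A (?ys i)) \<le> N (\<Sum>i<Suc m. ?g k i *\<^sub>R A (?ys i)) + N (\<Sum>i<Suc m. (b i - ?g k i) *\<^sub>R A (?ys i))"
        using tri by simp
      also have "N (\<Sum>i<Suc m. (b i - ?g k i) *\<^sub>R A (?ys i)) \<le> (\<Sum>i<Suc m. N ((b i - ?g k i) *\<^sub>R A (?ys i)))"
        by (rule N_sum) simp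
      also have "\<dots> \<le> (\<Sum>i<Suc m. 1 / real q * L)"
        unfolding scale using k(3) ys nonneg by (intro sum_mono mult_mono) auto
      also have "\<dots> = L * Suc m / q" by simp
      also have "\<dots> \<le> e" by (rule qe)
      finally have "N (\<Sum>i<Suc m. b i *\<^sub>R A (?ys i)) \<le> c * iter_op f (Suc m) b + 2 * e * 1"
        using 1 by simp
      also have "\<dots> \<le> c * iter_op f (Suc m) b + 2 * e * iter_op f (Suc m) b"
        using abs_le_iter_op[OF j(1), of b] j(2) e by (intro add_left_mono mult_left_mono) auto
      also have "\<dots> = c' * iter_op f (Suc m) b"
        unfolding distrib_right[symmetric] by (simp add: e_def field_simps del: iter_op.simps)
      finally show ?thesis .
    qed
    define \<mu> where "\<mu> = Max ((\<lambda>i. \<bar>a i\<bar>) ` {..<Suc m})"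
    have \<mu>: "\<bar>a i\<bar> \<le> \<mu>" if "i < Suc m" for i
      unfolding \<mu>_def using that by (intro Max_ge) auto
    have "\<mu> \<in> (\<lambda>i. \<bar>a i\<bar>) ` {..<Suc m}"
      unfolding \<mu>_def by (intro Max_in) (auto simp: lessThan_Suc)
    then obtain j where j: "j < Suc m" "\<mu> = \<bar>a j\<bar>" by auto
    show ?thesis
    proof (cases "\<mu> = 0")
      case True
      then have "(\<Sum>i<Suc m. a i *\<^sub>R A (?ys i)) = 0"
        using \<mu> by (intro sum.neutral) auto
      then show ?thesis
        using N0 iter_op_nonneg[of "Suc m" a] C by (simp del: sum.lessThan_Suc iter_op.simps)
    next
      case False
      then have pos: "0 < \<mu>" using j by simp
      have *: "N (\<Sum>i<Suc m. (inverse \<mu> * a i) *\<^sub>R A (?ys i)) \<le> c' * iter_op f (Suc m) (\<lambda>i. inverse \<mu> * a i)"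
        using \<mu> j pos by (intro unit[of _ j]) (auto simp: abs_mult field_simps)
      have "(\<Sum>i<Suc m. (inverse \<mu> * a i) *\<^sub>R A (?ys i)) = inverse \<mu> *\<^sub>R (\<Sum>i<Suc m. a i *\<^sub>R A (?ys i))"
        by (simp only: scaleR_sum_right scaleR_scaleR)
      with * have "inverse \<mu> * N (\<Sum>i<Suc m. a i *\<^sub>R A (?ys i)) \<le> inverse \<mu> * (c' * iter_op f (Suc m) a)"
        using pos by (simp only: scale iter_op_scale) (simp add: mult.left_commute del: sum.lessThan_Suc iter_op.simps)
      then show ?thesis
        using pos by (simp del: sum.lessThan_Suc iter_op.simps)
    qed
  qed
  with V show ?thesis by blast
qed

section \<open>Tree estimates obtained from smooth norms\<close>

text \<open>In the complex case \<open>J\<close> is an isometry, being multiplication by a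
  unimodular scalar; in the real case the imaginary parts vanish.\<close>

lemma norm_sum_sc_le:
  assumes K: "scalar_field K J" and a: "\<And>i. a i \<in> K"
  shows "norm (\<Sum>i<n. sc J (a i) (z i)) \<le> norm (\<Sum>i<n. Re (a i) *\<^sub>R z i) + norm (\<Sum>i<n. Im (a i) *\<^sub>R z i)"
proof (cases "K = \<real>")
  case True
  then have "Im (a i) = 0" for i using a[of i] by (auto simp: complex_is_Real_iff)
  then show ?thesis by (simp add: sc_def)
next
  case False
  then have K': "\<i> \<in> K" "linear J" using K by (auto simp: scalar_field_def complex_structure_def)
  have J: "J y = sc J \<i> y" for y by (simp add: sc_def)
  have "(\<Sum>i<n. sc J (a i) (z i)) = (\<Sum>i<n. Re (a i) *\<^sub>R z i) + J (\<Sum>i<n. Im (a i) *\<^sub>R z i)"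
    by (simp add: sc_def sum.distrib linear_sum[OF K'(2)] linear_scale[OF K'(2)])
  moreover have "norm (J y) = norm y" for y
    using norm_sc[OF K K'(1)] by (simp add: J)
  ultimately show ?thesis using norm_triangle_ineq by metis
qed

text \<open>The tuples that satisfy the estimate for real coefficients, with a constant depending on
  their length, already form an inevitable set by \<open>extend_estimate\<close>.\<close>

lemma (in norm_op) upper_tree_estI:
  fixes A :: "'a::real_normed_vector \<Rightarrow> 'b::real_normed_vector"
  assumes A: "bounded_linear A" and KY: "scalar_field K JY"
    and comm: "\<And>c x. c \<in> K \<Longrightarrow> A (sc JX c x) = sc JY c (A x)"
    and N: "equiv_K_norm K JY N"
    and step: "\<And>y r \<eta>. 0 < \<eta> \<Longrightarrow>
      \<exists>U\<in>weak_nbhds0. \<forall>x\<in>U. norm x \<le> 1 \<longrightarrow> N (y + r *\<^sub>R A x) \<le> f (N y) (C * \<bar>r\<bar>) + \<eta>"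
    and C: "0 < C"
    and ph: "\<And>n a. 0 < n \<Longrightarrow> ph a n = iter_op f n (\<lambda>i. cmod (a i))"
  shows "\<exists>C>0. upper_tree_est K JX A C ph"
proof -
  have lin: "linear A" using A by (rule bounded_linear.linear)
  from N have nonneg: "\<And>y. 0 \<le> N y" and tri: "\<And>y z. N (y + z) \<le> N y + N z"
    by (auto simp: equiv_K_norm_def)
  obtain \<alpha> \<beta> where \<alpha>: "0 < \<alpha>" "\<And>y. \<alpha> * norm y \<le> N y" and \<beta>: "0 < \<beta>" "\<And>y. N y \<le> \<beta> * norm y"
    using N by (auto simp: equiv_K_norm_def)
  note scale = equiv_K_norm_scaleR[OF N KY]
  have L: "N (A x) \<le> \<beta> * onorm A" if "norm x \<le> 1" for x
  proof -
    have "norm (A x) \<le> onorm A * norm x" by (rule onorm[OF A])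
    also have "\<dots> \<le> onorm A * 1" using that onorm_pos_le[OF A] by (intro mult_left_mono)
    finally have "\<beta> * norm (A x) \<le> \<beta> * onorm A"
      using \<beta>(1) by simp
    with \<beta>(2)[of "A x"] show ?thesis by simp
  qed
  \<comment> \<open>Strictly increasing, as every extension needs room, but bounded by
    \<open>2 * C\<close>; it starts at \<open>c 0 = C\<close>.\<close>
  define c where "c n = C * (2 - (1 / 2) ^ n)" for n :: nat
  have c: "C \<le> c n" "c n < c (Suc n)" "c n \<le> 2 * C" for n
  proof -
    have "(1 / 2 :: real) ^ n \<le> 1" by (rule power_le_one) auto
    then show "C \<le> c n" using C by (simp add: c_def)
    show "c n < c (Suc n)" "c n \<le> 2 * C" using C by (simp_all add: c_def)
  qed
  \<comment> \<open>The bound \<open>2 * C\<close> is doubled by real and imaginary parts and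
    divided by \<open>\<alpha>\<close> on return to the original norm.\<close>
  have "big weak_nbhds0 {t \<in> tuples weak_nbhds0. \<forall>a. (\<forall>i. a i \<in> K) \<longrightarrow>
           norm (A (\<Sum>i<length t. sc JX (a i) (x (take (Suc i) t)))) \<le> (4 * C / \<alpha>) * ph a (length t)}"
    if x: "normally_weakly_null weak_nbhds0 x" "\<forall>t\<in>tuples weak_nbhds0. norm (x t) \<le> 1" for x
  proof -
    define P where "P t \<longleftrightarrow> (\<forall>a. N (\<Sum>i<length t. a i *\<^sub>R A (x (take (Suc i) t))) \<le> c (length t) * iter_op f (length t) a)" for t
    define B where "B = {t \<in> tuples weak_nbhds0. P t}"
    have ev: "eventual weak_nbhds0 {u \<in> weak_nbhds0. t @ [u] \<in> B}" if t: "t \<in> insert [] B" for t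
    proof -
      have "set t \<subseteq> weak_nbhds0" using t by (auto simp: B_def tuples_def)
      then have take: "take (Suc i) t \<in> tuples weak_nbhds0" if "i < length t" for i
        using that set_take_subset[of "Suc i" t] by (auto simp: tuples_def)
      have "P t" using t N scale[of 0 0] by (auto simp: B_def P_def)
      then obtain U where U: "U \<in> weak_nbhds0"
        "\<And>z a. z \<in> U \<Longrightarrow> norm z \<le> 1 \<Longrightarrow> N (\<Sum>i<Suc (length t). a i *\<^sub>R A (((\<lambda>i. x (take (Suc i) t))(length t := z)) i))
           \<le> c (Suc (length t)) * iter_op f (Suc (length t)) a"
        using extend_estimate[of N A "\<beta> * onorm A" C "c (length t)" "c (Suc (length t))" "length t" "\<lambda>i. x (take (Suc i) t)",
            OF tri scale L step nonneg _ c(1,2)] C x(2) take unfolding P_def by force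
      have "t @ [v] \<in> B" if v: "v \<in> weak_nbhds0" "v \<subseteq> U" for v
      proof -
        have tv: "t @ [v] \<in> tuples weak_nbhds0"
          using v \<open>set t \<subseteq> _\<close> by (auto simp: tuples_def)
        then have "x (t @ [v]) \<in> last (t @ [v])" "norm (x (t @ [v])) \<le> 1"
          using x unfolding normally_weakly_null_def by blast+
        then have "x (t @ [v]) \<in> U" "norm (x (t @ [v])) \<le> 1"
          using v by auto
        from U(2)[OF this] have "N (\<Sum>i<Suc (length t). a i *\<^sub>R A (x (take (Suc i) (t @ [v]))))
            \<le> c (Suc (length t)) * iter_op f (Suc (length t)) a" for a
          by simp
        then show ?thesis using tv by (simp add: B_def P_def)
      qed
      then show ?thesis unfolding eventual_def using U(1) by blast
    qed
    have "inevitable weak_nbhds0 B"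
      unfolding inevitable_def using ev[of "[]"] ev by (auto simp: B_def)
    moreover have "norm (A (\<Sum>i<length t. sc JX (a i) (x (take (Suc i) t)))) \<le> (4 * C / \<alpha>) * ph a (length t)"
      if t: "t \<in> B" and a: "\<And>i. a i \<in> K" for t a
    proof -
      let ?n = "length t" and ?z = "\<lambda>i. A (x (take (Suc i) t))"
      have n: "0 < ?n" using t by (auto simp: B_def tuples_def)
      have real_est: "norm (\<Sum>i<?n. b i *\<^sub>R ?z i) \<le> (2 * C / \<alpha>) * ph a ?n"
        if "\<And>i. \<bar>b i\<bar> \<le> cmod (a i)" for b
      proof -
        have "\<alpha> * norm (\<Sum>i<?n. b i *\<^sub>R ?z i) \<le> N (\<Sum>i<?n. b i *\<^sub>R ?z i)" by (rule \<alpha>)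
        also have "\<dots> \<le> c ?n * iter_op f ?n b" using t by (simp add: B_def P_def)
        also have "\<dots> \<le> (2 * C) * ph a ?n"
          unfolding ph[OF n] using c that C by (intro mult_mono iter_op_mono iter_op_nonneg) auto
        finally show ?thesis using \<alpha>(1) by (simp add: field_simps)
      qed
      have "norm (A (\<Sum>i<?n. sc JX (a i) (x (take (Suc i) t)))) = norm (\<Sum>i<?n. sc JY (a i) (?z i))"
        using a by (simp add: linear_sum[OF lin] comm)
      also have "\<dots> \<le> norm (\<Sum>i<?n. Re (a i) *\<^sub>R ?z i) + norm (\<Sum>i<?n. Im (a i) *\<^sub>R ?z i)"
        by (rule norm_sum_sc_le[OF KY a])
      also have "\<dots> \<le> (2 * C / \<alpha>) * ph a ?n + (2 * C / \<alpha>) * ph a ?n"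
        by (intro add_mono real_est abs_Re_le_cmod abs_Im_le_cmod)
      finally show ?thesis by simp
    qed
    ultimately show ?thesis
      unfolding big_def by (intro exI[of _ B]) (auto simp: B_def)
  qed
  then have "upper_tree_est K JX A (4 * C / \<alpha>) ph"
    unfolding upper_tree_est_def by blast
  moreover have "0 < 4 * C / \<alpha>" using C \<alpha> by simp
  ultimately show ?thesis by blast
qed

lemma AUF_able_imp_c0_ute:
  fixes A :: "'a::real_normed_vector \<Rightarrow> 'b::real_normed_vector"
  assumes A: "bounded_linear A" and KY: "scalar_field K JY"
    and comm: "\<And>c x. c \<in> K \<Longrightarrow> A (sc JX c x) = sc JY c (A x)"
    and able: "AUF_able K JY A"
  shows "\<exists>C>0. c0_ute K JX A C"
proof -
  obtain N \<sigma> where N: "equiv_K_norm K JY N" and \<sigma>: "0 < \<sigma>" "aus_mod N A \<sigma> = 0"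
    using able by (auto simp: AUF_able_def AUF_def)
  have lin: "linear A" using A by (rule bounded_linear.linear)
  note scale = equiv_K_norm_scaleR[OF N KY]
  have nonneg: "0 \<le> N y" for y using N by (simp add: equiv_K_norm_def)
  interpret norm_op max by (rule norm_op_max)
  show ?thesis unfolding c0_ute_def
  proof (rule upper_tree_estI[OF A KY comm N])
    fix y r \<eta> assume \<eta>: "0 < (\<eta>::real)"
    \<comment> \<open>The least scale at which \<open>y /\<^sub>R n\<close> lies in the unit ball of
      \<open>N\<close> and \<open>(r / n) *\<^sub>R x\<close> in the ball of radius
      \<open>\<sigma>\<close>.\<close>
    define n where "n = max (N y) (1 / \<sigma> * \<bar>r\<bar>)"
    show "\<exists>U\<in>weak_nbhds0. \<forall>x\<in>U. norm x \<le> 1 \<longrightarrow> N (y + r *\<^sub>R A x) \<le> max (N y) (1 / \<sigma> * \<bar>r\<bar>) + \<eta>"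
    proof (cases "n = 0")
      case True
      then have "r = 0" using \<sigma> nonneg[of y] by (auto simp: n_def max_def divide_le_0_iff split: if_splits)
      then show ?thesis using UNIV_weak_nbhds0 \<eta> by force
    next
      case False
      then have n: "0 < n" using nonneg[of y] by (auto simp: n_def less_max_iff_disj order_less_le)
      have "N (y /\<^sub>R n) \<le> 1" using n by (simp add: scale divide_inverse[symmetric] field_simps n_def)
      then obtain U where U: "U \<in> weak_nbhds0" "\<And>x. x \<in> U \<Longrightarrow> norm x \<le> \<sigma> \<Longrightarrow> N (y /\<^sub>R n + A x) \<le> 1 + 0 + \<eta> / n"
        using aus_mod_leD[of N A \<sigma> 0 "y /\<^sub>R n" "\<eta> / n"] \<sigma> n \<eta> by (auto simp: zero_ereal_def)
      have "N (y + r *\<^sub>R A x) \<le> n + \<eta>" if x: "x \<in> (*\<^sub>R) (r / n) -` U" "norm x \<le> 1" for x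
      proof -
        have "1 / \<sigma> * \<bar>r\<bar> \<le> n" by (simp add: n_def)
        then have "\<bar>r\<bar> \<le> \<sigma> * n" using \<sigma> by (simp add: field_simps)
        then have "\<bar>r / n\<bar> * norm x \<le> \<sigma> * 1"
          using x n \<sigma> by (intro mult_mono) (auto simp: field_simps)
        then have "N (y /\<^sub>R n + A ((r / n) *\<^sub>R x)) \<le> 1 + \<eta> / n"
          using U(2)[of "(r / n) *\<^sub>R x"] x by simp
        moreover have "y /\<^sub>R n + A ((r / n) *\<^sub>R x) = (y + r *\<^sub>R A x) /\<^sub>R n"
          by (simp add: linear_scale[OF lin] scaleR_add_right divide_inverse mult.commute)
        ultimately have "N (y + r *\<^sub>R A x) / n \<le> 1 + \<eta> / n"
          using n by (simp add: scale divide_inverse_commute)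
        then have "N (y + r *\<^sub>R A x) \<le> (1 + \<eta> / n) * n"
          using n by (simp add: pos_divide_le_eq)
        then show ?thesis using n by (simp add: distrib_right)
      qed
      moreover have "(*\<^sub>R) (r / n) -` U \<in> weak_nbhds0"
        using U(1) by (intro weak_nbhds0_vimage bounded_linear_scaleR_right)
      ultimately show ?thesis unfolding n_def by blast
    qed
  next
    show "Max ((\<lambda>i. cmod (a i)) ` {..<n}) = iter_op max n (\<lambda>i. cmod (a i))" if "0 < n" for n a
      using iter_op_max[OF that, of "\<lambda>i. cmod (a i)"] by simp
  qed (use \<sigma> in auto)
qed

text \<open>\<open>1 + M * s\<close> is a convex combination of 1 and \<open>1 + M\<close>. With
  \<open>s = \<tau> powr p\<close> this turns the modulus bound into an estimate by the
  \<open>p\<close>-norm of a pair.\<close>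

lemma one_plus_powr_le:
  fixes s M p :: real
  assumes "0 \<le> s" "s \<le> 1" "0 \<le> M" "1 \<le> p"
  shows "(1 + M * s) powr p \<le> 1 + (1 + M) powr p * s"
proof -
  have "(1 + M * s) powr p = ((1 - s) *\<^sub>R 1 + s *\<^sub>R (1 + M)) powr p"
    by (simp add: algebra_simps)
  also have "\<dots> \<le> (1 - s) * 1 powr p + s * (1 + M) powr p"
    using assms by (intro convex_onD[OF powr_convex_nonneg]) auto
  also have "\<dots> \<le> 1 + (1 + M) powr p * s"
    using assms by (simp add: mult.commute)
  finally show ?thesis .
qed

lemma p_AUS_able_imp_lp_ute:
  fixes A :: "'a::real_normed_vector \<Rightarrow> 'b::real_normed_vector"
  assumes A: "bounded_linear A" and KY: "scalar_field K JY"
    and comm: "\<And>c x. c \<in> K \<Longrightarrow> A (sc JX c x) = sc JY c (A x)"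
    and p: "1 < p" and able: "p_AUS_able K JY p A"
  shows "\<exists>C>0. lp_ute K JX p A C"
proof -
  obtain N M' where N: "equiv_K_norm K JY N" and M': "\<And>\<sigma>. 0 < \<sigma> \<Longrightarrow> aus_mod N A \<sigma> \<le> ereal (M' * \<sigma> powr p)"
    using able by (auto simp: p_AUS_able_def p_AUS_def)
  define M where "M = max M' 0"
  have M: "aus_mod N A \<sigma> \<le> ereal (M * \<sigma> powr p)" if "0 < \<sigma>" for \<sigma>
    using M'[OF that] by (rule order_trans) (simp add: M_def mult_right_mono)
  have M0: "0 \<le> M" by (simp add: M_def)
  have lin: "linear A" using A by (rule bounded_linear.linear)
  note scale = equiv_K_norm_scaleR[OF N KY]
  have nonneg: "0 \<le> N y" and tri: "N (y + z) \<le> N y + N z" for y z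
    using N by (auto simp: equiv_K_norm_def)
  obtain \<beta>' where \<beta>': "0 < \<beta>'" "\<And>y. N y \<le> \<beta>' * norm y"
    using N by (auto simp: equiv_K_norm_def)
  define \<beta> where "\<beta> = \<beta>' * onorm A"
  have \<beta>0: "0 \<le> \<beta>" using \<beta>' onorm_pos_le[OF A] by (simp add: \<beta>_def)
  have \<beta>: "N (A x) \<le> \<beta>" if "norm x \<le> 1" for x
  proof -
    have "norm (A x) \<le> onorm A * norm x" by (rule onorm[OF A])
    also have "\<dots> \<le> onorm A * 1" using that onorm_pos_le[OF A] by (intro mult_left_mono)
    finally have "\<beta>' * norm (A x) \<le> \<beta>"
      using \<beta>'(1) by (simp add: \<beta>_def)
    with \<beta>'(2)[of "A x"] show ?thesis by simp
  qed
  \<comment> \<open>\<open>1 + \<beta>\<close> serves the case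
    \<open>N y \<le> \<bar>r\<bar>\<close>, \<open>1 + M\<close> the opposite one.\<close>
  define C where "C = 1 + M + \<beta>"
  have C: "0 < C" using M0 \<beta>0 by (simp add: C_def)
  let ?f = "\<lambda>a b. (a powr p + b powr p) powr (1 / p)"
  interpret norm_op ?f by (rule norm_op_lp[OF p])
  show ?thesis unfolding lp_ute_def
  proof (rule upper_tree_estI[OF A KY comm N])
    fix y r \<eta> assume \<eta>: "0 < (\<eta>::real)"
    define n where "n = N y"
    show "\<exists>U\<in>weak_nbhds0. \<forall>x\<in>U. norm x \<le> 1 \<longrightarrow> N (y + r *\<^sub>R A x) \<le> ?f (N y) (C * \<bar>r\<bar>) + \<eta>"
    \<comment> \<open>For large \<open>\<tau> = \<bar>r\<bar> / n\<close> a bound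
      \<open>1 + M * \<tau> powr p\<close> with \<open>M > 0\<close> outgrows the
      \<open>p\<close>-norm of the pair, which is of linear order; there the triangle inequality is
      used instead.\<close>
    proof (cases "n \<le> \<bar>r\<bar>")
      case True
      have "N (y + r *\<^sub>R A x) \<le> ?f (N y) (C * \<bar>r\<bar>) + \<eta>" if "norm x \<le> 1" for x
      proof -
        have "N (y + r *\<^sub>R A x) \<le> n + \<bar>r\<bar> * N (A x)"
          using tri[of y "r *\<^sub>R A x"] by (simp add: scale n_def)
        also have "\<dots> \<le> \<bar>r\<bar> + \<bar>r\<bar> * \<beta>"
          using True \<beta>[OF that] by (intro add_mono mult_left_mono) auto
        also have "\<dots> \<le> C * \<bar>r\<bar>"
          using M0 by (simp add: C_def algebra_simps)
        also have "\<dots> \<le> ?f (N y) (C * \<bar>r\<bar>)"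
          using C nonneg by (intro upper2) auto
        finally show ?thesis using \<eta> by simp
      qed
      then show ?thesis using UNIV_weak_nbhds0 by blast
    next
      case False
      then have n: "0 < n" by simp
      define \<tau> where "\<tau> = \<bar>r\<bar> / n"
      have \<tau>: "0 \<le> \<tau>" "\<tau> \<le> 1" using n False by (auto simp: \<tau>_def)
      show ?thesis
      proof (cases "r = 0")
        case True
        have "N y \<le> ?f (N y) (C * \<bar>r\<bar>)" using C nonneg by (intro upper1) auto
        then show ?thesis using True UNIV_weak_nbhds0 \<eta> by force
      next
        case False
        then have \<tau>0: "0 < \<tau>" using n by (simp add: \<tau>_def)
        have "N (y /\<^sub>R n) \<le> 1" using n by (simp add: scale n_def)
        then obtain U where U: "U \<in> weak_nbhds0"
          "\<And>x. x \<in> U \<Longrightarrow> norm x \<le> \<tau> \<Longrightarrow> N (y /\<^sub>R n + A x) \<le> 1 + M * \<tau> powr p + \<eta> / n"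
          using aus_mod_leD[OF M[OF \<tau>0], of "y /\<^sub>R n" "\<eta> / n"] \<tau> n \<eta> M0 by auto
        have s: "0 \<le> \<tau> powr p" "\<tau> powr p \<le> 1" using \<tau> p by (auto intro: powr_le1)
        have "(1 + M * \<tau> powr p) powr p \<le> 1 + (1 + M) powr p * \<tau> powr p"
          using s M0 p by (intro one_plus_powr_le) auto
        also have "\<dots> \<le> 1 + C powr p * \<tau> powr p"
          using M0 \<beta>0 p by (intro add_left_mono mult_right_mono powr_mono2) (auto simp: C_def)
        finally have "((1 + M * \<tau> powr p) powr p) powr (1 / p) \<le> (1 + C powr p * \<tau> powr p) powr (1 / p)"
          using p by (intro powr_mono2) auto
        then have le: "1 + M * \<tau> powr p \<le> ?f 1 (C * \<tau>)"
          using M0 p C \<tau> by (simp add: powr_powr powr_mult)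
        have "N (y + r *\<^sub>R A x) \<le> ?f (N y) (C * \<bar>r\<bar>) + \<eta>" if x: "x \<in> (*\<^sub>R) (r / n) -` U" "norm x \<le> 1" for x
        proof -
          have "\<bar>r / n\<bar> * norm x \<le> \<tau> * 1"
            using x n \<tau> by (intro mult_mono) (auto simp: \<tau>_def)
          then have "N (y /\<^sub>R n + A ((r / n) *\<^sub>R x)) \<le> 1 + M * \<tau> powr p + \<eta> / n"
            using U(2)[of "(r / n) *\<^sub>R x"] x by simp
          moreover have "y /\<^sub>R n + A ((r / n) *\<^sub>R x) = (y + r *\<^sub>R A x) /\<^sub>R n"
            by (simp add: linear_scale[OF lin] scaleR_add_right divide_inverse mult.commute)
          ultimately have "N (y + r *\<^sub>R A x) / n \<le> ?f 1 (C * \<tau>) + \<eta> / n"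
            using n le by (simp add: scale divide_inverse_commute)
          then have "N (y + r *\<^sub>R A x) \<le> n * (?f 1 (C * \<tau>) + \<eta> / n)"
            using n by (simp add: pos_divide_le_eq mult.commute)
          also have "\<dots> = n * ?f 1 (C * \<tau>) + \<eta>"
            using n by (simp add: distrib_left)
          also have "n * ?f 1 (C * \<tau>) = ?f (n * 1) (n * (C * \<tau>))"
            using n C \<tau> by (intro homogeneous[symmetric]) auto
          also have "n * (C * \<tau>) = C * \<bar>r\<bar>" using n by (simp add: \<tau>_def)
          finally show ?thesis by (simp add: n_def)
        qed
        moreover have "(*\<^sub>R) (r / n) -` U \<in> weak_nbhds0"
          using U(1) by (intro weak_nbhds0_vimage bounded_linear_scaleR_right)
        ultimately show ?thesis by blast
      qed
    qed
  next
    show "(\<Sum>i<n. cmod (a i) powr p) powr (1 / p) = iter_op ?f n (\<lambda>i. cmod (a i))" for n a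
      using iter_op_lp[OF p, of n "\<lambda>i. cmod (a i)"] by simp
  qed (use C in auto)
qed

theorem theorem1p1:
  fixes A :: "'a::banach \<Rightarrow> 'b::banach"
    and K :: "complex set" and JX :: "'a \<Rightarrow> 'a" and JY :: "'b \<Rightarrow> 'b"
  assumes K: "K = \<real> \<or> K = UNIV"
    and cplx: "K = UNIV \<Longrightarrow> complex_structure JX \<and> complex_structure JY \<and> (\<forall>x. A (JX x) = JY (A x))"
    and A: "bounded_linear A"
  shows "(AUF_able K JY A \<longleftrightarrow> (\<exists>C>0. c0_ute K JX A C)) \<and>
         (\<forall>p. 1 < p \<longrightarrow> (p_AUS_able K JY p A \<longleftrightarrow> (\<exists>C>0. lp_ute K JX p A C)))"
proof -
  have lin: "linear A" using A by (rule bounded_linear.linear)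
  have KX: "scalar_field K JX" and KY: "scalar_field K JY"
    using K cplx by (auto simp: scalar_field_def)
  have comm: "A (sc JX c x) = sc JY c (A x)" if "c \<in> K" for c x
  proof (cases "K = \<real>")
    case True
    then show ?thesis
      using that by (auto simp: sc_def linear_scale[OF lin] elim!: Reals_cases)
  next
    case False
    then have "A (JX x) = JY (A x)" using K cplx by blast
    then show ?thesis by (simp add: sc_def linear_add[OF lin] linear_scale[OF lin])
  qed
  show ?thesis
    using AUF_able_imp_c0_ute[OF A KY comm] c0_ute_imp_AUF_able[OF lin KX KY comm]
      p_AUS_able_imp_lp_ute[OF A KY comm] lp_ute_imp_p_AUS_able[OF lin KX KY comm]
    by blast
qed

end
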